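(* Let $n\ge 1$ and $k\ge 2$ be integers and let $[k]=\{0,1,\dots,k-1\}$. Let $(w_i)_{i=0}^{k^n-1}$ be the $(k,n)$-prefer-max cycle, with indices read modulo $k^n$ (so the predecessor of $w_0$ is $w_{k^n-1}$). Define $\mathrm{shift}\colon [k]^n\to[k]^n$ by, for $x\in[k]^{n-1}$ and $\sigma\in[k]$, $$\mathrm{shift}(x\sigma)=\begin{cases}(\sigma+1)x & \text{if } \sigma<k-1 \text{ and } tail(x(\sigma+1))=n-1,\\ 0x & \text{else, if } tail(x\sigma)=n-1,\\ \sigma x & \text{otherwise.}\end{cases}$$ Then for every $i$, $\mathrm{shift}(w_i)=w_{i-1}$, i.e. $\mathrm{shift}$ maps each vertex of the prefer-max cycle to its predecessor on the cycle. Moreover, $\mathrm{shift}$ can be computed in $O(n)$ time and $O(n)$ memory.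
   Context: Words over $[k]$ are written by concatenation; for $x\in[k]^{n-1}$ and $\sigma\in[k]$, $x\sigma$ and $\sigma x$ are words in $[k]^n$. The $(k,n)$-prefer-max cycle is the sequence $(w_i)_{i=0}^{k^n-1}$ with $w_0=0^{n-1}(k-1)$ and, if $w_i=\sigma x$ with $\sigma\in[k]$, $x\in[k]^{n-1}$, then $w_{i+1}=x\tau$ where $\tau$ is the maximal letter with $x\tau\notin\{w_0,\dots,w_i\}$. It is known (Martin) that this is well defined for all $i<k^n-1$ and that $w_0,\dots,w_{k^n-1}$ is an enumeration of $[k]^n$ forming a Hamiltonian cycle in the De Bruijn graph. For $s=\sigma_0\cdots\sigma_{n-1}\in[k]^n$ and $0\le m<n$: $val(s,m)=\sum_{i=1}^n \sigma_{(m-i)\bmod n}k^{i-1}$; $head(s)=\min\{m\in\{0,\dots,n-1\} : val(s,m)=\max_{0\le m'<n} val(s,m')\}$; and for $s\ne 0^n$, $tail(s)=\big(\max\{i\in\mathbb{Z} : i<head(s),\ \sigma_{i\bmod n}\ne 0\}\big)\bmod n$. (In the definition of $\mathrm{shift}$, $tail$ is only evaluated on nonzero words.) Complexity is measured in the standard word-RAM model, where elementary operations on letters of $[k]$ and on integers of $O(\log(nk))$ bits take unit time. *)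

theory Defs
  imports Complex_Main "HOL-Library.Log_Nat"
begin

section \<open>Words and the prefer-max cycle\<close>

definition words :: "nat \<Rightarrow> nat \<Rightarrow> nat list set" where
  "words k n = {s. length s = n \<and> set s \<subseteq> {..<k}}"

text \<open>The recursion describes the cycle for indices below \<open>k ^ n\<close> only; beyond that, \<open>Max\<close> is
  applied to an empty set and the value is irrelevant.\<close>

fun prefer_max :: "nat \<Rightarrow> nat \<Rightarrow> nat \<Rightarrow> nat list" where
  "prefer_max k n 0 = replicate (n - 1) 0 @ [k - 1]"
| "prefer_max k n (Suc i) =
     (let x = tl (prefer_max k n i)
      in x @ [Max {\<tau>. \<tau> < k \<and> x @ [\<tau>] \<notin> (\<lambda>j. prefer_max k n j) ` {..i}}])"

text \<open>The cycle with its indices read modulo \<open>k ^ n\<close>.\<close>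

definition prefer_max_cycle :: "nat \<Rightarrow> nat \<Rightarrow> int \<Rightarrow> nat list" where
  "prefer_max_cycle k n i = prefer_max k n (nat (i mod int (k ^ n)))"


section \<open>The map shift\<close>

text \<open>The letter of a word at an integer position, read modulo the length of the word.\<close>

definition letter :: "nat list \<Rightarrow> int \<Rightarrow> nat" where
  "letter s i = s ! nat (i mod int (length s))"

definition word_val :: "nat \<Rightarrow> nat list \<Rightarrow> nat \<Rightarrow> nat" where
  "word_val k s m = (\<Sum>i = 1..length s. letter s (int m - int i) * k ^ (i - 1))"

definition word_head :: "nat \<Rightarrow> nat list \<Rightarrow> nat" where
  "word_head k s =
     Min {m \<in> {..<length s}. word_val k s m = Max (word_val k s ` {..<length s})}"

text \<open>The position below the head may be negative before reduction; the maximum exists exactly if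
  some letter of the word is nonzero.\<close>

definition word_tail :: "nat \<Rightarrow> nat list \<Rightarrow> nat" where
  "word_tail k s =
     nat ((GREATEST i :: int. i < int (word_head k s) \<and> letter s i \<noteq> 0) mod int (length s))"

definition shift :: "nat \<Rightarrow> nat list \<Rightarrow> nat list" where
  "shift k s =
     (let x = butlast s; \<sigma> = last s; n = length s in
      if \<sigma> < k - 1 \<and> word_tail k (x @ [\<sigma> + 1]) = n - 1 then (\<sigma> + 1) # x
      else if word_tail k (x @ [\<sigma>]) = n - 1 then 0 # x
      else \<sigma> # x)"


section \<open>A word RAM\<close>

text \<open>Registers and memory cells hold words of \<open>w\<close> bits, represented by the natural numbers below
  \<open>2 ^ w\<close>; arithmetic is modulo \<open>2 ^ w\<close>. Operands of instructions are registers, and \<open>Load\<close> and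
  \<open>Store\<close> address the memory indirectly through a register. Every instruction takes unit time. A
  program mentions only finitely many registers, so these contribute a constant to the memory.\<close>

datatype arith_op = Add | Sub | Mult | Div | Mod

datatype instr =
    Imm nat nat                 \<comment> \<open>\<open>Imm r v\<close>: \<open>r := v\<close>\<close>
  | Arith arith_op nat nat nat  \<comment> \<open>\<open>Arith f r a b\<close>: \<open>r := f a b\<close>\<close>
  | Load nat nat                \<comment> \<open>\<open>Load r a\<close>: \<open>r := mem[a]\<close>\<close>
  | Store nat nat               \<comment> \<open>\<open>Store a r\<close>: \<open>mem[a] := r\<close>\<close>
  | Jump nat
  | Jump_less nat nat nat       \<comment> \<open>\<open>Jump_less a b l\<close>: if \<open>a < b\<close> go to \<open>l\<close>\<close>
  | Jump_eq nat nat nat         \<comment> \<open>\<open>Jump_eq a b l\<close>: if \<open>a = b\<close> go to \<open>l\<close>\<close>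

record config =
  pc :: nat
  reg :: "nat \<Rightarrow> nat"
  mem :: "nat \<Rightarrow> nat"

fun arith :: "nat \<Rightarrow> arith_op \<Rightarrow> nat \<Rightarrow> nat \<Rightarrow> nat" where
  "arith w Add a b = (a + b) mod 2 ^ w"
| "arith w Sub a b = (a + 2 ^ w - b) mod 2 ^ w"
| "arith w Mult a b = (a * b) mod 2 ^ w"
| "arith w Div a b = a div b"
| "arith w Mod a b = a mod b"

fun exec :: "nat \<Rightarrow> instr \<Rightarrow> config \<Rightarrow> config" where
  "exec w (Imm r v) c = c\<lparr>pc := pc c + 1, reg := (reg c)(r := v mod 2 ^ w)\<rparr>"
| "exec w (Arith f r a b) c =
     c\<lparr>pc := pc c + 1, reg := (reg c)(r := arith w f (reg c a) (reg c b))\<rparr>"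
| "exec w (Load r a) c = c\<lparr>pc := pc c + 1, reg := (reg c)(r := mem c (reg c a))\<rparr>"
| "exec w (Store a r) c = c\<lparr>pc := pc c + 1, mem := (mem c)(reg c a := reg c r)\<rparr>"
| "exec w (Jump l) c = c\<lparr>pc := l\<rparr>"
| "exec w (Jump_less a b l) c = c\<lparr>pc := (if reg c a < reg c b then l else pc c + 1)\<rparr>"
| "exec w (Jump_eq a b l) c = c\<lparr>pc := (if reg c a = reg c b then l else pc c + 1)\<rparr>"

text \<open>A program halts by leaving its own code.\<close>

definition halted :: "instr list \<Rightarrow> config \<Rightarrow> bool" where
  "halted P c \<longleftrightarrow> length P \<le> pc c"

definition step :: "nat \<Rightarrow> instr list \<Rightarrow> config \<Rightarrow> config" where
  "step w P c = (if halted P c then c else exec w (P ! pc c) c)"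

definition run :: "nat \<Rightarrow> instr list \<Rightarrow> nat \<Rightarrow> config \<Rightarrow> config" where
  "run w P t c = (step w P ^^ t) c"

fun instr_access :: "instr \<Rightarrow> config \<Rightarrow> nat set" where
  "instr_access (Load r a) c = {reg c a}"
| "instr_access (Store a r) c = {reg c a}"
| "instr_access _ c = {}"

text \<open>The memory cells accessed by the next step.\<close>

definition accessed :: "instr list \<Rightarrow> config \<Rightarrow> nat set" where
  "accessed P c = (if halted P c then {} else instr_access (P ! pc c) c)"

text \<open>The input \<open>s\<close>, a word over the alphabet of size \<open>k\<close>, is stored in the first cells of the
  memory; its length and \<open>k\<close> are given in the first two registers.\<close>

definition init_config :: "nat \<Rightarrow> nat list \<Rightarrow> config" where
  "init_config k s =
     \<lparr>pc = 0,
      reg = (\<lambda>_. 0)(0 := length s, 1 := k),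
      mem = (\<lambda>a. if a < length s then s ! a else 0)\<rparr>"

text \<open>With word length \<open>w\<close>, on input \<open>s\<close> the program \<open>P\<close> halts after at most \<open>T\<close> steps, uses only
  the first \<open>S\<close> memory cells, and leaves the word \<open>s'\<close> in the first cells of the memory.\<close>

definition computes_within ::
    "nat \<Rightarrow> instr list \<Rightarrow> nat \<Rightarrow> nat list \<Rightarrow> nat list \<Rightarrow> nat \<Rightarrow> nat \<Rightarrow> bool" where
  "computes_within w P k s s' T S \<longleftrightarrow>
     length s \<le> S \<and> length s' \<le> S \<and>
     (\<exists>t \<le> T. halted P (run w P t (init_config k s)) \<and>
        map (mem (run w P t (init_config k s))) [0..<length s'] = s' \<and>
        (\<forall>j < t. accessed P (run w P j (init_config k s)) \<subseteq> {..<S}))"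

text \<open>\<open>floorlog 2 m\<close> is the number of binary digits of \<open>m\<close>. For \<open>c > 0\<close> the word length is
  \<open>O(log (n k))\<close>, and \<open>n\<close>, \<open>k\<close> and all letters fit into a word.\<close>

definition word_length :: "nat \<Rightarrow> nat \<Rightarrow> nat \<Rightarrow> nat" where
  "word_length c n k = c * floorlog 2 (n * k)"

end

theory Submission
  imports Defs "HOL-Library.List_Lexorder"
begin

text \<open>Write a nonzero word as \<open>0\<^sup>j p\<close> with \<open>p\<close> starting with a nonzero letter. Its tail is \<open>n - 1\<close> exactly
  if \<open>p\<close> ends with a nonzero letter and \<open>p 0\<^sup>j\<close> is maximal among its rotations; such words are called
  good. For fixed \<open>x\<close> the letters \<open>a > 0\<close> with \<open>x a\<close> good form an initial segment, so \<open>shift\<close> is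
  injective. Assign to every word the key \<open>p k\<^sup>j\<close> if \<open>p 0\<^sup>j\<close> is a maximal rotation, and its maximal
  rotation otherwise. In lexicographic order, \<open>key (x a)\<close> increases with \<open>a\<close>, and
  \<open>shift\<close> never decreases the key except at \<open>0\<^sup>n\<^sup>-\<^sup>1 (k - 1)\<close>; it preserves the key only if it merely
  rotates a word that is not good. As every nonzero word has a good rotation, all orbits of \<open>shift\<close>
  pass through \<open>0\<^sup>n\<^sup>-\<^sup>1 (k - 1)\<close>, so \<open>shift\<close> is a single cycle. Traversed backwards from there, the
  keys never increase, hence \<open>x b\<close> precedes \<open>x a\<close> for \<open>a < b\<close>, which is the greedy rule.

  In linear time, a word is compared with its rotations by one scan of two periods, which skips all
  rotations starting inside a matched prefix as soon as a smaller letter follows the match.\<close>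

section \<open>Lexicographic order and rotations\<close>

lemma append_less_append_iff [simp]: "xs @ ys < xs @ zs \<longleftrightarrow> ys < (zs :: nat list)"
  by (induction xs) auto

lemma append_le_append_iff [simp]: "xs @ ys \<le> xs @ zs \<longleftrightarrow> ys \<le> (zs :: nat list)"
  by (induction xs) auto

lemma take_mono_lex: "xs \<le> ys \<Longrightarrow> take a xs \<le> take a (ys :: nat list)"
proof (induction a arbitrary: xs ys)
  case (Suc a)
  then show ?case by (cases xs; cases ys) auto
qed simp

lemma take_less_lexD: "take a xs < take a ys \<Longrightarrow> xs < (ys :: nat list)"
  by (metis leD leI take_mono_lex)

lemma replicate_mono_lex: "a \<le> b \<Longrightarrow> replicate j a \<le> replicate j (b :: nat)"
  by (induction j) auto

section \<open>Maximal rotations and necklaces\<close>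

definition maxrot :: "nat list \<Rightarrow> bool" where
  "maxrot s \<longleftrightarrow> (\<forall>i. rotate i s \<le> s)"

definition necklace :: "nat list \<Rightarrow> nat list" where
  "necklace s = Max (range (\<lambda>i. rotate i s))"

lemma finite_rotations: "finite (range (\<lambda>i. rotate i s))"
proof (rule finite_subset)
  show "range (\<lambda>i. rotate i s) \<subseteq> {l. set l \<subseteq> set s \<and> length l = length s}"
    by auto
qed (simp add: finite_lists_length_eq)

lemma rotate_le_necklace: "rotate i s \<le> necklace s"
  unfolding necklace_def using finite_rotations by (intro Max_ge) auto

lemma necklace_eq_rotate: "\<exists>i. necklace s = rotate i s"
  using Max_in[OF finite_rotations[of s]] unfolding necklace_def by auto

lemma le_necklace: "s \<le> necklace s"
  using rotate_le_necklace[of 0 s] by simp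

lemma rotate_inverse: "\<exists>j. rotate j (rotate i s) = s"
proof -
  have "rotate ((length s - 1) * i) (rotate i s) = rotate (length s * i) s"
    by (cases s) (auto simp: rotate_rotate algebra_simps)
  also have "\<dots> = s"
    by (subst rotate_conv_mod) simp
  finally show ?thesis by blast
qed

lemma necklace_rotate_le: "necklace (rotate i s) \<le> necklace s"
  by (metis necklace_eq_rotate rotate_le_necklace rotate_rotate)

lemma necklace_rotate [simp]: "necklace (rotate i s) = necklace s"
  by (metis antisym necklace_rotate_le rotate_inverse)

lemma necklace_snoc: "necklace (x @ [a]) = necklace (a # x)"
  using necklace_rotate[of 1 "a # x"] by simp

lemma maxrot_iff_necklace: "maxrot s \<longleftrightarrow> necklace s = s"
  by (metis antisym le_necklace maxrot_def necklace_eq_rotate rotate_le_necklace)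

lemma maxrot_necklace: "maxrot (necklace s)"
  by (metis maxrot_iff_necklace necklace_eq_rotate necklace_rotate)

lemma length_necklace [simp]: "length (necklace s) = length s"
  by (metis necklace_eq_rotate length_rotate)

lemma set_necklace [simp]: "set (necklace s) = set s"
  by (metis necklace_eq_rotate set_rotate)

text \<open>The two rotations differ only at the cell where the last letter lands, which decides the
  comparison.\<close>

lemma rotate_snoc_less:
  assumes "a < (b :: nat)"
  shows "rotate i (x @ [a]) < rotate i (x @ [b])"
proof -
  define j where "j = i mod Suc (length x)"
  have j: "j \<le> length x" unfolding j_def by (simp add: less_Suc_eq_le[symmetric])
  have *: "rotate i (x @ [c]) = drop j x @ c # take j x" for c
    using j unfolding rotate_drop_take j_def by simp
  show ?thesis unfolding * using assms by simp
qed

lemma necklace_snoc_less: "a < b \<Longrightarrow> necklace (x @ [a]) < necklace (x @ [b])"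
  by (metis necklace_eq_rotate order_less_le_trans rotate_le_necklace rotate_snoc_less)

lemma maxrot_hd:
  assumes "maxrot s" "a \<in> set s" "a \<noteq> 0"
  shows "hd s \<noteq> 0"
proof
  assume "hd s = 0"
  obtain u v where s: "s = u @ a # v" using assms(2) by (meson split_list)
  have "rotate (length u) s \<le> s" using assms(1) by (simp add: maxrot_def)
  hence "a # v @ u \<le> s" unfolding s rotate_append by simp
  with \<open>hd s = 0\<close> \<open>a \<noteq> 0\<close> assms(2) show False by (cases s) auto
qed

text \<open>Lowering the last letter before the final zeros of a maximal rotation keeps it maximal: a
  rotation starting inside \<open>u\<close> meets the lowered letter before it can exceed the prefix \<open>u\<close>.\<close>

lemma maxrot_lower:
  assumes max: "maxrot (u @ b # replicate j 0)" and u: "u \<noteq> []" "hd u \<noteq> 0" and "a \<le> b"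
  shows "maxrot (u @ a # replicate j 0)"
proof (cases "a = b")
  case False
  with \<open>a \<le> b\<close> have ab: "a < b" by simp
  show ?thesis unfolding maxrot_def
  proof
    fix i
    define n where "n = length u + Suc j"
    define m where "m = i mod n"
    have "m < n" unfolding m_def n_def by simp
    have rot: "rotate i (u @ c # replicate j 0) = drop m (u @ c # replicate j 0) @ take m (u @ c # replicate j 0)"
      for c by (simp add: rotate_drop_take m_def n_def)
    consider "m = 0" | "m \<ge> 1" "m \<le> length u" | "m > length u" by linarith
    then show "rotate i (u @ a # replicate j 0) \<le> u @ a # replicate j 0"
    proof cases
      case 2
      \<comment> \<open>Length of the rotation's prefix ending with the replaced letter. Since
        \<open>m \<ge> 1\<close>, it is at most \<open>length u\<close>, so the same prefix of the
        unrotated word does not contain that letter.\<close>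
      define l where "l = Suc (length u - m)"
      have l: "l \<le> length u" using 2 u by (simp add: l_def)
      have tk: "take l (rotate i (u @ c # replicate j 0)) = drop m u @ [c]" for c
        using 2 unfolding rot by (simp add: l_def)
      have "drop m u @ [b] \<le> take l (u @ b # replicate j 0)"
        using take_mono_lex[of _ _ l] max tk by (metis maxrot_def)
      hence "drop m u @ [b] \<le> take l u" using l by simp
      moreover have "drop m u @ [a] < drop m u @ [b]" using ab by simp
      ultimately have "drop m u @ [a] < take l u" by (rule order_less_le_trans[rotated])
      hence "take l (rotate i (u @ a # replicate j 0)) < take l (u @ a # replicate j 0)"
        using l tk by simp
      thus ?thesis using take_less_lexD by (meson less_imp_le)
    next
      case 3
      obtain m' where m': "m = Suc (length u + m')" using 3 less_iff_Suc_add by auto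
      have "m' < j" using \<open>m < n\<close> m' by (simp add: n_def)
      then obtain j' where "j - m' = Suc j'" by (metis Suc_diff_Suc)
      hence "drop m (u @ a # replicate j 0) = 0 # replicate j' 0" unfolding m' by simp
      thus ?thesis unfolding rot using u by (cases u) auto
    qed (simp add: rot)
  qed
qed (use max in simp)


section \<open>Good words\<close>

definition zeros :: "nat list \<Rightarrow> nat" where
  "zeros s = length (takeWhile (\<lambda>a. a = 0) s)"

definition core :: "nat list \<Rightarrow> nat list" where
  "core s = dropWhile (\<lambda>a. a = 0) s"

text \<open>The maximality half of goodness, separated because \<open>key\<close> depends on it
  whatever the last letter is.\<close>

definition aligned :: "nat list \<Rightarrow> bool" where
  "aligned s \<longleftrightarrow> core s \<noteq> [] \<and> maxrot (core s @ replicate (zeros s) 0)"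

definition good :: "nat list \<Rightarrow> bool" where
  "good s \<longleftrightarrow> aligned s \<and> last s \<noteq> 0"

lemma zeros_core: "replicate (zeros s) 0 @ core s = s"
proof -
  have "replicate (zeros s) 0 = takeWhile (\<lambda>a. a = 0) s"
    unfolding zeros_def by (rule sym) (rule replicate_eqI, auto dest: set_takeWhileD)
  thus ?thesis by (simp add: core_def)
qed

lemma hd_core: "core s \<noteq> [] \<Longrightarrow> hd (core s) \<noteq> 0"
  unfolding core_def by (rule hd_dropWhile)

lemma core_replicate [simp]: "p \<noteq> [] \<Longrightarrow> hd p \<noteq> 0 \<Longrightarrow> core (replicate j 0 @ p) = p"
  unfolding core_def by (cases p) (auto simp: dropWhile_append)

lemma zeros_replicate [simp]: "p \<noteq> [] \<Longrightarrow> hd p \<noteq> 0 \<Longrightarrow> zeros (replicate j 0 @ p) = j"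
  unfolding zeros_def by (cases p) (auto simp: takeWhile_append)

lemma core_eq_Nil_iff: "core s = [] \<longleftrightarrow> set s \<subseteq> {0}"
  unfolding core_def by auto

lemma aligned_replicate [simp]:
  "p \<noteq> [] \<Longrightarrow> hd p \<noteq> 0 \<Longrightarrow> aligned (replicate j 0 @ p) \<longleftrightarrow> maxrot (p @ replicate j 0)"
  by (simp add: aligned_def)

lemma alignedE:
  assumes "aligned s"
  obtains j p where "s = replicate j 0 @ p" "p \<noteq> []" "hd p \<noteq> 0" "maxrot (p @ replicate j 0)"
  using assms zeros_core hd_core unfolding aligned_def by metis

text \<open>Supplies the case of an empty \<open>u\<close>, which \<open>maxrot_lower\<close>
  excludes. For \<open>a = 0\<close> all rotations coincide; otherwise every nontrivial one starts
  with 0.\<close>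

lemma maxrot_unit: "maxrot (a # replicate j 0)"
  unfolding maxrot_def
proof
  fix i
  have "rotate i (a # replicate j 0) = drop (i mod Suc j) (a # replicate j 0) @ take (i mod Suc j) (a # replicate j 0)"
    by (simp add: rotate_drop_take)
  also have "\<dots> \<le> a # replicate j 0"
  proof (cases "i mod Suc j")
    case (Suc m)
    have "i mod Suc j < Suc j" by simp
    with Suc have "m < j" by simp
    then obtain j' where j': "j - m = Suc j'" "j = m + Suc j'" using less_iff_Suc_add[of m j] that by auto
    have "replicate j' 0 @ a # replicate m 0 \<le> replicate j 0" if "a = 0"
      using that j'(2) by (simp add: add.commute flip: replicate_Suc replicate_add)
    hence "(0 # replicate j' 0) @ (a # replicate m 0) \<le> a # replicate j 0"
      by (cases "a = 0") simp_all
    moreover have "drop (Suc m) (a # replicate j 0) = 0 # replicate j' 0"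
      unfolding drop_Suc_Cons drop_replicate j'(1) by simp
    moreover have "take (Suc m) (a # replicate j 0) = a # replicate m 0"
      using \<open>m < j\<close> by (simp add: min_def)
    ultimately show ?thesis unfolding Suc by (simp only:)
  qed simp
  finally show "rotate i (a # replicate j 0) \<le> a # replicate j 0" .
qed

lemma good_unit: "a \<noteq> 0 \<Longrightarrow> good (replicate j 0 @ [a])"
  using maxrot_unit[of a j] by (simp add: good_def)

lemma good_snocE:
  assumes "good (x @ [a])" "x \<noteq> replicate (length x) 0"
  obtains j u where "x = replicate j 0 @ u" "u \<noteq> []" "hd u \<noteq> 0" "maxrot (u @ a # replicate j 0)"
proof -
  from assms(1) obtain j p where p: "x @ [a] = replicate j 0 @ p" "p \<noteq> []" "hd p \<noteq> 0" "maxrot (p @ replicate j 0)"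
    unfolding good_def by (metis alignedE)
  define u where "u = butlast p"
  have pu: "p = u @ [a]" using p(1,2) by (metis append_butlast_last_id last_appendR last_snoc u_def)
  hence x: "x = replicate j 0 @ u" using p(1) by simp
  hence "u \<noteq> []" using assms(2) by auto
  thus ?thesis using that[of j u] p pu x by auto
qed

lemma good_lower:
  assumes "good (x @ [b])" "a \<le> b" "a \<noteq> 0"
  shows "good (x @ [a])"
proof (cases "x = replicate (length x) 0")
  case True
  then show ?thesis using good_unit[OF assms(3), of "length x"] by simp
next
  case False
  from good_snocE[OF assms(1) False] obtain j u where u:
    "x = replicate j 0 @ u" "u \<noteq> []" "hd u \<noteq> 0" "maxrot (u @ b # replicate j 0)" .
  from maxrot_lower[OF u(4,2,3) assms(2)] have "maxrot (u @ a # replicate j 0)" .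
  thus ?thesis using u assms(3) aligned_replicate[of "u @ [a]" j] by (simp add: good_def)
qed

text \<open>The necklace starts with a nonzero letter; moving its final zeros to the front yields a
  good word.\<close>

lemma exists_good_rotation:
  assumes "a \<in> set s" "a \<noteq> 0"
  shows "\<exists>i. good (rotate i s)"
proof -
  obtain i where i: "necklace s = rotate i s" using necklace_eq_rotate by blast
  define N where "N = necklace s"
  have max: "maxrot N" unfolding N_def by (rule maxrot_necklace)
  have hdN: "hd N \<noteq> 0" using maxrot_hd[OF max, of a] assms by (simp add: N_def)
  define z where "z = rev (takeWhile (\<lambda>a. a = 0) (rev N))"
  define p where "p = rev (dropWhile (\<lambda>a. a = 0) (rev N))"
  have N: "N = p @ z" unfolding z_def p_def by (metis rev_append rev_rev_ident takeWhile_dropWhile_id)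
  have z: "z = replicate (length z) 0" unfolding z_def
    by (rule replicate_eqI) (auto dest: set_takeWhileD)
  have "a \<in> set N" using assms by (simp add: N_def)
  hence "dropWhile (\<lambda>a. a = 0) (rev N) \<noteq> []" using assms(2) by auto
  hence p: "p \<noteq> []" "last p \<noteq> 0" unfolding p_def
    using hd_dropWhile[of "\<lambda>a. a = 0" "rev N"] by (auto simp: last_rev)
  have "rotate (length p) N = replicate (length z) 0 @ p"
    unfolding N rotate_append using z by simp
  moreover have "good (replicate (length z) 0 @ p)"
    using p hdN max z aligned_replicate[of p "length z"] unfolding N by (simp add: good_def)
  ultimately have "good (rotate (length p + i) s)"
    unfolding N_def i by (simp add: rotate_rotate)
  thus ?thesis by blast
qed

section \<open>Head and tail\<close>

fun digits_val :: "nat \<Rightarrow> nat list \<Rightarrow> nat" where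
  "digits_val k [] = 0"
| "digits_val k (a # l) = a * k ^ length l + digits_val k l"

lemma digits_val_bound: "set l \<subseteq> {..<k} \<Longrightarrow> digits_val k l < k ^ length l"
proof (induction l)
  case (Cons a l)
  hence "a * k ^ length l + digits_val k l < (a + 1) * k ^ length l" by simp
  also have "\<dots> \<le> k * k ^ length l" using Cons.prems by (intro mult_right_mono) auto
  finally show ?case by simp
qed simp

lemma digits_val_less:
  "length l = length m \<Longrightarrow> set l \<subseteq> {..<k} \<Longrightarrow> l < m \<Longrightarrow> digits_val k l < digits_val k m"
proof (induction l m rule: list_induct2)
  case (Cons a l b m)
  show ?case
  proof (cases "a = b")
    case False
    hence "a + 1 \<le> b" using Cons.prems by auto
    have "digits_val k (a # l) < (a + 1) * k ^ length l" using digits_val_bound[of l k] Cons.prems by simp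
    also have "\<dots> \<le> b * k ^ length l" using \<open>a + 1 \<le> b\<close> by (rule mult_right_mono) simp
    finally show ?thesis using Cons.hyps by simp
  qed (use Cons in auto)
qed simp

lemma digits_val_le_iff:
  assumes "length l = length m" "set l \<subseteq> {..<k}" "set m \<subseteq> {..<k}"
  shows "digits_val k l \<le> digits_val k m \<longleftrightarrow> l \<le> m"
proof (cases l m rule: linorder_cases)
  case less
  thus ?thesis using digits_val_less[of l m k] assms by simp
next
  case greater
  thus ?thesis using digits_val_less[of m l k] assms by simp
qed simp

lemma digits_val_eq_sum: "digits_val k l = (\<Sum>i = 1..length l. l ! (length l - i) * k ^ (i - 1))"
proof (induction l)
  case (Cons a l)
  have "(\<Sum>i = 1..length l. (a # l) ! (Suc (length l) - i) * k ^ (i - 1)) = digits_val k l"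
    unfolding Cons by (rule sum.cong) (auto simp: Suc_diff_le)
  thus ?case by simp
qed simp

text \<open>The letter just before \<open>m\<close> has weight 1, so \<open>word_val\<close> reads
  the word cyclically from \<open>m\<close> as a base-\<open>k\<close> numeral.\<close>

lemma word_val_eq_digits_val:
  assumes "s \<noteq> []"
  shows "word_val k s m = digits_val k (rotate m s)"
proof -
  let ?n = "length s"
  have "letter s (int m - int i) = rotate m s ! (?n - i)" if "i \<in> {1..?n}" for i
  proof -
    have "(int m - int i) mod int ?n = (int m + int (?n - i)) mod int ?n"
      using that mod_add_self2[of "int m - int i" "int ?n"] by (simp add: of_nat_diff algebra_simps)
    also have "\<dots> = int ((m + (?n - i)) mod ?n)" by (simp add: zmod_int)
    finally show ?thesis using that assms by (simp add: letter_def nth_rotate)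
  qed
  thus ?thesis unfolding word_val_def digits_val_eq_sum by simp
qed

text \<open>For words over \<open>[k]\<close> of equal length, numerical and lexicographic order
  agree, so the maximal values occur exactly at the starts of the necklace.\<close>

lemma word_head_necklace:
  assumes "s \<noteq> []" "set s \<subseteq> {..<k}"
  shows "word_head k s < length s" "rotate (word_head k s) s = necklace s"
    "m < length s \<Longrightarrow> rotate m s = necklace s \<Longrightarrow> word_head k s \<le> m"
proof -
  let ?H = "{m \<in> {..<length s}. word_val k s m = Max (word_val k s ` {..<length s})}"
  have le: "word_val k s m \<le> word_val k s m' \<longleftrightarrow> rotate m s \<le> rotate m' s" for m m'
    unfolding word_val_eq_digits_val[OF assms(1)] using assms(2) by (intro digits_val_le_iff) auto
  have *: "m \<in> ?H \<longleftrightarrow> m < length s \<and> rotate m s = necklace s" for m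
  proof
    assume m: "m \<in> ?H"
    obtain i where i: "necklace s = rotate i s" using necklace_eq_rotate by blast
    have "i mod length s < length s" using assms(1) by simp
    hence "word_val k s (i mod length s) \<le> word_val k s m" using m by simp
    hence "rotate i s \<le> rotate m s" unfolding le by (simp flip: rotate_conv_mod)
    thus "m < length s \<and> rotate m s = necklace s" using m i rotate_le_necklace[of m s] by auto
  next
    assume m: "m < length s \<and> rotate m s = necklace s"
    hence "word_val k s m' \<le> word_val k s m" for m'
      unfolding le using rotate_le_necklace by simp
    hence "Max (word_val k s ` {..<length s}) = word_val k s m"
      using m by (intro Max_eqI) auto
    thus "m \<in> ?H" using m by simp
  qed
  have fin: "finite ?H" by simp
  obtain i where i: "necklace s = rotate i s" using necklace_eq_rotate by blast
  have "i mod length s \<in> ?H" unfolding * using assms(1) i by (simp flip: rotate_conv_mod)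
  hence "word_head k s \<in> ?H" unfolding word_head_def using Min_in[OF fin] by blast
  thus "word_head k s < length s" "rotate (word_head k s) s = necklace s" using * by blast+
  show "word_head k s \<le> m" if "m < length s" "rotate m s = necklace s"
    unfolding word_head_def using that * by (intro Min_le[OF fin]) blast
qed

lemma letter_nat: "i < length s \<Longrightarrow> letter s (int i) = s ! i"
  by (simp add: letter_def)

lemma letter_add_length: "letter s (i + int (length s)) = letter s i"
  by (simp add: letter_def)

lemma letter_minus_one: "s \<noteq> [] \<Longrightarrow> letter s (- 1) = last s"
proof -
  assume "s \<noteq> []"
  hence "letter s (int (length s - 1)) = last s" by (simp add: letter_nat last_conv_nth)
  moreover have "int (length s - 1) = - 1 + int (length s)" using \<open>s \<noteq> []\<close> by (cases s) auto
  ultimately show ?thesis using letter_add_length[of s "- 1"] by metis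
qed

text \<open>Going down from the head, the search passes all positions \<open>\<ge> 0\<close> before
  \<open>- 1\<close>, which reduces to the last position.\<close>

lemma word_tail_last_iff:
  assumes a: "a \<in> set s" "a \<noteq> 0" and head: "word_head k s < length s"
  shows "word_tail k s = length s - 1 \<longleftrightarrow> last s \<noteq> 0 \<and> (\<forall>i < word_head k s. s ! i = 0)"
proof -
  define n where "n = length s"
  define h where "h = word_head k s"
  have hn: "h < n" using head by (simp add: h_def n_def)
  have "s \<noteq> []" using a by auto
  \<comment> \<open>One full period below the head contains a position of every letter, so the
    maximum exists and can be taken in a finite set.\<close>
  define G where "G = {i \<in> {int h - int n..<int h}. letter s i \<noteq> 0}"
  have fin: "finite G" unfolding G_def by (rule finite_subset[of _ "{int h - int n..<int h}"]) auto
  obtain m where m: "m < n" "s ! m \<noteq> 0" using a unfolding n_def in_set_conv_nth by auto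
  have "(if m < h then int m else int m - int n) \<in> G"
    using m hn letter_nat[of m s] letter_add_length[of s "int m - int n"]
    unfolding G_def n_def by auto
  hence "Max G \<in> G" using Max_in[OF fin] by blast
  have ub: "i \<le> Max G" if "i < int h" "letter s i \<noteq> 0" for i
  proof (cases "int h - int n \<le> i")
    case True
    thus ?thesis using that Max_ge[OF fin, of i] by (simp add: G_def)
  qed (use \<open>Max G \<in> G\<close> in \<open>simp add: G_def\<close>)
  have "(GREATEST i. i < int h \<and> letter s i \<noteq> 0) = Max G"
    using \<open>Max G \<in> G\<close> ub by (intro Greatest_equality) (auto simp: G_def)
  hence tail: "word_tail k s = nat (Max G mod int n)"
    by (simp add: word_tail_def h_def n_def)
  have G: "Max G < int h" "letter s (Max G) \<noteq> 0" "- int n \<le> Max G"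
    using \<open>Max G \<in> G\<close> by (auto simp: G_def)
  \<comment> \<open>Only \<open>- 1\<close> reduces to \<open>n - 1\<close>: nonnegative positions
    are below \<open>h < n\<close>, and the others are at least \<open>- n\<close>.\<close>
  have "word_tail k s = n - 1 \<longleftrightarrow> Max G = - 1"
  proof (cases "Max G < 0")
    case True
    have "Max G mod int n = (Max G + int n) mod int n" by simp
    also have "\<dots> = Max G + int n" using True G(3) by (intro mod_pos_pos_trivial) auto
    finally show ?thesis unfolding tail using True G hn by (auto simp: nat_eq_iff)
  next
    case False
    thus ?thesis unfolding tail using G(1) hn by (auto simp: nat_eq_iff)
  qed
  also have "\<dots> \<longleftrightarrow> last s \<noteq> 0 \<and> (\<forall>i < h. s ! i = 0)"
  proof
    assume M: "Max G = - 1"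
    have "s ! i = 0" if "i < h" for i
      using ub[of "int i"] that M hn letter_nat[of i s] unfolding n_def by auto
    thus "last s \<noteq> 0 \<and> (\<forall>i < h. s ! i = 0)"
      using G(2) M letter_minus_one[OF \<open>s \<noteq> []\<close>] by auto
  next
    assume z: "last s \<noteq> 0 \<and> (\<forall>i < h. s ! i = 0)"
    have "Max G < 0"
    proof (rule ccontr)
      assume "\<not> Max G < 0"
      then obtain i where i: "Max G = int i" by (metis nonneg_int_cases not_less)
      thus False using G z hn letter_nat[of i s] unfolding n_def by auto
    qed
    moreover have "- 1 \<le> Max G"
      using z letter_minus_one[OF \<open>s \<noteq> []\<close>] by (intro ub) auto
    ultimately show "Max G = - 1" by simp
  qed
  finally show ?thesis by (simp add: n_def h_def)
qed

lemma zeros_nth: "i < zeros s \<Longrightarrow> s ! i = 0"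
  using arg_cong[OF zeros_core[of s], of "\<lambda>l. l ! i"] by (simp add: nth_append)

lemma rotate_zeros: "rotate (zeros s) s = core s @ replicate (zeros s) 0"
  using rotate_append[of "replicate (zeros s) 0" "core s"] by (simp add: zeros_core)

text \<open>The necklace starts with a nonzero letter, so the head lies outside the leading zeros.
  It has only zeros before it exactly if it is \<open>zeros s\<close>, where the rotation is
  \<open>core s\<close> followed by the leading zeros.\<close>

lemma tail_iff_good:
  assumes a: "a \<in> set s" "a \<noteq> 0" and s: "set s \<subseteq> {..<k}"
  shows "word_tail k s = length s - 1 \<longleftrightarrow> good s"
proof -
  have "s \<noteq> []" using a by auto
  note head = word_head_necklace[OF this s]
  let ?h = "word_head k s"
  have hd: "hd (necklace s) \<noteq> 0" using maxrot_hd[OF maxrot_necklace, of a s] a by simp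
  have hd_rot: "hd (rotate m s) = s ! m" if "m < length s" for m
    using that \<open>s \<noteq> []\<close> by (simp add: hd_rotate_conv_nth)
  have "core s \<noteq> []" using a by (auto simp: core_eq_Nil_iff)
  hence zs: "zeros s < length s"
    using arg_cong[OF zeros_core[of s], of length] by (cases "core s") auto
  have "(\<forall>i < ?h. s ! i = 0) \<longleftrightarrow> rotate (zeros s) s = necklace s"
  proof
    assume z: "\<forall>i < ?h. s ! i = 0"
    have "s ! zeros s \<noteq> 0"
      using hd_core[OF \<open>core s \<noteq> []\<close>] hd_rot[OF zs] \<open>core s \<noteq> []\<close> unfolding rotate_zeros by simp
    hence "?h \<le> zeros s" using z by (meson not_le)
    moreover have "\<not> ?h < zeros s" using zeros_nth[of ?h s] hd_rot[OF head(1)] hd head(2) by auto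
    ultimately show "rotate (zeros s) s = necklace s" using head(2) by simp
  next
    assume "rotate (zeros s) s = necklace s"
    thus "\<forall>i < ?h. s ! i = 0" using head(3)[OF zs] zeros_nth[of _ s] by auto
  qed
  also have "\<dots> \<longleftrightarrow> aligned s"
    unfolding aligned_def maxrot_iff_necklace rotate_zeros[symmetric]
    using \<open>core s \<noteq> []\<close> by auto
  finally show ?thesis
    using word_tail_last_iff[OF a head(1)] by (auto simp: good_def)
qed

lemma shift_snoc:
  assumes "x @ [a] \<in> words k n" "2 \<le> k"
  shows "shift k (x @ [a]) =
    (if a + 1 < k \<and> good (x @ [a + 1]) then (a + 1) # x else if good (x @ [a]) then 0 # x else a # x)"
proof -
  have set: "set x \<subseteq> {..<k}" "a < k" using assms(1) by (auto simp: words_def)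
  have "word_tail k (x @ [a + 1]) = length x \<longleftrightarrow> good (x @ [a + 1])" if "a + 1 < k"
    using tail_iff_good[of "a + 1" "x @ [a + 1]" k] set that by simp
  moreover have "word_tail k (x @ [a]) = length x \<longleftrightarrow> good (x @ [a])"
    if "\<not> (a + 1 < k \<and> good (x @ [a + 1]))"
  proof -
    \<comment> \<open>In the zero word, \<open>a + 1 = 1\<close> would be a valid letter and make
      the word good, the case excluded here. So this tail is not that of the zero word.\<close>
    have "\<exists>b \<in> set (x @ [a]). b \<noteq> 0"
    proof (rule ccontr)
      assume "\<not> ?thesis"
      hence "a = 0" "x = replicate (length x) 0" by (auto intro: replicate_eqI)
      moreover from this good_unit[of 1 "length x"] have "good (x @ [a + 1])" by simp
      ultimately show False using that assms(2) by simp
    qed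
    thus ?thesis using tail_iff_good[of _ "x @ [a]" k] set by auto
  qed
  ultimately show ?thesis using set(2) unfolding shift_def by (auto simp: Let_def less_diff_conv)
qed

section \<open>The cycle of shift\<close>

text \<open>Padding with \<open>k\<close>, which exceeds every letter, makes the key rise when the
  last letter of the core is exchanged for a leading zero.\<close>

definition key :: "nat \<Rightarrow> nat list \<Rightarrow> nat list" where
  "key k s = (if aligned s then core s @ replicate (zeros s) k else necklace s)"

lemma key_aligned:
  "p \<noteq> [] \<Longrightarrow> hd p \<noteq> 0 \<Longrightarrow> maxrot (p @ replicate j 0) \<Longrightarrow> key k (replicate j 0 @ p) = p @ replicate j k"
  by (simp add: key_def)

lemma necklace_le_key: "necklace s \<le> key k s"
proof (cases "aligned s")
  case True
  hence "necklace s = core s @ replicate (zeros s) 0"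
    by (metis aligned_def maxrot_iff_necklace necklace_rotate rotate_zeros)
  thus ?thesis using True replicate_mono_lex[of 0 k "zeros s"] by (simp add: key_def)
qed (simp add: key_def)

text \<open>For an aligned word the last letter of the core decides the comparison before the
  padding is reached. The bound by a necklace is invariant under the rotation that
  \<open>shift\<close> performs.\<close>

lemma key_snoc_less_necklace:
  assumes "a < b"
  shows "key k (x @ [a]) < necklace (x @ [b])"
proof (cases "aligned (x @ [a])")
  case True
  then obtain j p where p: "x @ [a] = replicate j 0 @ p" "p \<noteq> []" "hd p \<noteq> 0" "maxrot (p @ replicate j 0)"
    by (rule alignedE)
  define u where "u = butlast p"
  have pu: "p = u @ [a]" using p(1,2) by (metis append_butlast_last_id last_appendR last_snoc u_def)
  have x: "x = replicate j 0 @ u" using p(1) pu by simp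
  have "key k (x @ [a]) = u @ a # replicate j k" unfolding p(1) using key_aligned[OF p(2-4)] pu by simp
  also have "\<dots> < u @ b # replicate j 0" using assms by simp
  also have "\<dots> = rotate j (x @ [b])"
    unfolding x using rotate_append[of "replicate j 0" "u @ [b]"] by simp
  also have "\<dots> \<le> necklace (x @ [b])" by (rule rotate_le_necklace)
  finally show ?thesis .
qed (use assms necklace_snoc_less in \<open>simp add: key_def\<close>)

lemma key_snoc_less: "a < b \<Longrightarrow> key k (x @ [a]) < key k (x @ [b])"
  using key_snoc_less_necklace necklace_le_key by (rule order_less_le_trans)

lemma words_snoc: "x @ [a] \<in> words k (Suc m) \<longleftrightarrow> x \<in> words k m \<and> a < k"
  by (auto simp: words_def)

lemma words_Cons: "a # x \<in> words k (Suc m) \<longleftrightarrow> x \<in> words k m \<and> a < k"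
  by (auto simp: words_def)

lemma words_SucE:
  assumes "s \<in> words k (Suc m)"
  obtains x a where "s = x @ [a]" "x \<in> words k m" "a < k"
proof -
  have "s \<noteq> []" using assms by (auto simp: words_def)
  then obtain x a where "s = x @ [a]" by (metis append_butlast_last_id)
  thus ?thesis using that assms words_snoc by metis
qed

lemma finite_words: "finite (words k n)"
  using finite_lists_length_eq[of "{..<k}" n] by (simp add: words_def conj_commute)

lemma card_words: "card (words k n) = k ^ n"
  using card_lists_length_eq[of "{..<k}" n] by (simp add: words_def conj_commute)

abbreviation start :: "nat \<Rightarrow> nat \<Rightarrow> nat list" where
  "start k m \<equiv> replicate m 0 @ [k - 1]"

section \<open>Monotonicity of the key and the orbits of \<open>shift\<close>\<close>

context
  fixes k m :: nat
  assumes k: "2 \<le> k"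
begin

lemma start_in_words: "start k m \<in> words k (Suc m)"
  using k by (auto simp: words_snoc words_def)

lemma shift_snoc_words:
  assumes "x \<in> words k m" "a < k"
  shows "shift k (x @ [a]) =
    (if a + 1 < k \<and> good (x @ [a + 1]) then (a + 1) # x else if good (x @ [a]) then 0 # x else a # x)"
  using assms k by (intro shift_snoc[of _ _ _ "Suc m"]) (auto simp: words_snoc)

lemma shift_in_words: "s \<in> words k (Suc m) \<Longrightarrow> shift k s \<in> words k (Suc m)"
  by (elim words_SucE) (auto simp: shift_snoc_words words_Cons)

lemma tl_shift: "s \<in> words k (Suc m) \<Longrightarrow> tl (shift k s) = butlast s"
  by (elim words_SucE) (auto simp: shift_snoc_words)

lemma not_good_snoc_0: "\<not> good (x @ [0])"
  by (simp add: good_def)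

text \<open>For fixed \<open>x\<close>, the letters \<open>a > 0\<close> with \<open>good (x @ [a])\<close> form an initial segment
  \<open>{1..l}\<close>, so \<open>shift\<close> permutes \<open>{0..l}\<close> cyclically and fixes the other letters.\<close>

lemma inj_on_shift: "inj_on (shift k) (words k (Suc m))"
proof (rule inj_onI)
  fix s t assume s: "s \<in> words k (Suc m)" and t: "t \<in> words k (Suc m)" and eq: "shift k s = shift k t"
  obtain x a where xa: "s = x @ [a]" "x \<in> words k m" "a < k" using s by (rule words_SucE)
  obtain y b where yb: "t = y @ [b]" "y \<in> words k m" "b < k" using t by (rule words_SucE)
  have [simp]: "y = x" using tl_shift[OF s] tl_shift[OF t] eq xa(1) yb(1) by simp
  have False if "a < b" "shift k (x @ [a]) = shift k (x @ [b])" "a < k" "b < k" for a b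
  proof -
    have *: "good (x @ [b]) \<Longrightarrow> good (x @ [a + 1])"
      by (rule good_lower) (use that in auto)
    have **: "b = a + 1 \<Longrightarrow> good (x @ [a + 1]) \<Longrightarrow> good (x @ [b])" by simp
    have ***: "good (x @ [a]) \<Longrightarrow> a \<noteq> 0" using not_good_snoc_0 by metis
    show False using that * ** *** xa(2) by (auto simp: shift_snoc_words split: if_splits)
  qed
  from this[of a b] this[of b a] show "s = t"
    using eq xa yb by (cases a b rule: linorder_cases) auto
qed

text \<open>Raising the last letter raises the key by \<open>key_snoc_less_necklace\<close>; trading
  it for a leading zero lengthens the padding. What remains is a plain rotation of a word that is
  not aligned, whose key is the necklace and cannot fall.\<close>

lemma key_shift:
  assumes s: "s \<in> words k (Suc m)" and "s \<noteq> start k m"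
  shows "key k s < key k (shift k s) \<or> key k s = key k (shift k s) \<and> s = rotate 1 (shift k s) \<and> \<not> good s"
proof -
  obtain x a where xa: "s = x @ [a]" "x \<in> words k m" "a < k" using s by (rule words_SucE)
  note sh = shift_snoc_words[OF xa(2,3)]
  have len: "length x = m" using xa by (simp add: words_def)
  consider "a + 1 < k \<and> good (x @ [a + 1])"
    | "\<not> (a + 1 < k \<and> good (x @ [a + 1]))" "good (x @ [a])"
    | "\<not> (a + 1 < k \<and> good (x @ [a + 1]))" "\<not> good (x @ [a])" by blast
  thus ?thesis
  proof cases
    case 1
    have "key k s < necklace (x @ [a + 1])" unfolding xa(1) by (rule key_snoc_less_necklace) simp
    also have "\<dots> \<le> key k ((a + 1) # x)" unfolding necklace_snoc by (rule necklace_le_key)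
    finally show ?thesis using sh 1 xa(1) by simp
  next
    case 2
    \<comment> \<open>For an all-zero \<open>x\<close>, every positive letter gives a good word, so
      only \<open>a = k - 1\<close> reaches this branch, which is the excluded word.\<close>
    have "x \<noteq> replicate (length x) 0"
    proof
      assume x: "x = replicate (length x) 0"
      hence "a + 1 = k" using 2(1) good_unit[of "a + 1" "length x"] xa(3)
        by (metis Suc_eq_plus1 Suc_lessI nat.distinct(1))
      thus False using assms(2) xa(1) x len by simp
    qed
    then obtain j u where u: "x = replicate j 0 @ u" "u \<noteq> []" "hd u \<noteq> 0" "maxrot (u @ a # replicate j 0)"
      using 2(2) by (metis good_snocE)
    have "maxrot (u @ 0 # replicate j 0)" using maxrot_lower[OF u(4,2,3)] by simp
    hence "key k (0 # x) = u @ replicate (Suc j) k"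
      using key_aligned[of u "Suc j" k] u by simp
    moreover have "key k s = u @ a # replicate j k"
      using key_aligned[of "u @ [a]" j k] u xa(1) by simp
    moreover have "shift k s = 0 # x" unfolding xa(1) sh using 2 by simp
    ultimately show ?thesis using xa(3) by simp
  next
    case 3
    hence sh: "shift k s = a # x" using sh xa(1) by simp
    show ?thesis
    proof (cases "aligned s")
      case True
      \<comment> \<open>An aligned word that is not good ends with 0, so the rotation again
        lengthens the padding.\<close>
      have "a = 0" using True 3(2) xa(1) by (simp add: good_def)
      obtain j p where p: "s = replicate j 0 @ p" "p \<noteq> []" "hd p \<noteq> 0" "maxrot (p @ replicate j 0)"
        using True by (rule alignedE)
      define u where "u = butlast p"
      have pu: "p = u @ [0]" using p(1,2) xa(1) \<open>a = 0\<close>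
        by (metis append_butlast_last_id last_appendR last_snoc u_def)
      have u: "u \<noteq> []" "hd u \<noteq> 0" using p(3) pu by (cases u; simp)+
      have x: "x = replicate j 0 @ u" using p(1) pu xa(1) by simp
      have "key k (0 # x) = u @ replicate (Suc j) k"
        using key_aligned[of u "Suc j" k] u p(4) pu x by simp
      moreover have "key k s = u @ 0 # replicate j k"
        unfolding p(1) using key_aligned[OF p(2-4)] pu by simp
      ultimately show ?thesis using sh \<open>a = 0\<close> k by simp
    next
      case False
      hence "key k s = necklace (a # x)" using xa(1) by (simp add: key_def necklace_snoc)
      thus ?thesis using necklace_le_key[of "a # x" k] sh 3(2) xa(1) by auto
    qed
  qed
qed

lemma shift_power_in_words: "s \<in> words k (Suc m) \<Longrightarrow> (shift k ^^ i) s \<in> words k (Suc m)"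
  by (induction i) (auto simp: shift_in_words)

text \<open>On an orbit avoiding \<open>start k m\<close> the key would be constant from its maximum
  on. Then \<open>shift\<close> only rotates words that are not good, contradicting
  \<open>exists_good_rotation\<close>.\<close>

lemma shift_reaches_start:
  assumes "s \<in> words k (Suc m)"
  shows "\<exists>i. (shift k ^^ i) s = start k m"
proof (rule ccontr)
  assume contra: "\<nexists>i. (shift k ^^ i) s = start k m"
  let ?K = "range (\<lambda>i. key k ((shift k ^^ i) s))"
  have "?K \<subseteq> key k ` words k (Suc m)" using shift_power_in_words[OF assms] by blast
  hence fin: "finite ?K" using finite_words finite_surj by blast
  obtain i0 where i0: "Max ?K = key k ((shift k ^^ i0) s)" using Max_in[OF fin] by auto
  define t where "t = (shift k ^^ i0) s"
  have t: "(shift k ^^ i) t \<in> words k (Suc m)" "(shift k ^^ i) t \<noteq> start k m" for i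
    using shift_power_in_words[OF assms] contra unfolding t_def by (metis funpow_add o_apply)+
  have max: "key k ((shift k ^^ i) t) \<le> key k t" for i
  proof -
    have "key k ((shift k ^^ (i + i0)) s) \<le> Max ?K" using fin by (intro Max_ge) auto
    thus ?thesis unfolding i0 t_def by (simp add: funpow_add)
  qed
  have same: "key k ((shift k ^^ i) t) = key k t" for i
  proof (induction i)
    case (Suc i)
    show ?case using key_shift[OF t, of i] max[of "Suc i"] Suc by auto
  qed simp
  have step: "rotate 1 ((shift k ^^ Suc i) t) = (shift k ^^ i) t" "\<not> good ((shift k ^^ i) t)" for i
    using key_shift[OF t, of i] same[of i] same[of "Suc i"] by auto
  have unrotate: "rotate i ((shift k ^^ i) t) = t" for i
  proof (induction i)
    case (Suc i)
    have "rotate (Suc i) ((shift k ^^ Suc i) t) = rotate i (rotate 1 ((shift k ^^ Suc i) t))"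
      by (simp only: rotate_rotate) simp
    thus ?case using step(1)[of i] Suc by simp
  qed simp
  have lt: "length t = Suc m" using t(1)[of 0] by (simp add: words_def)
  \<comment> \<open>Each step undoes \<open>rotate 1\<close>, which for length \<open>m + 1\<close>
    is rotation by \<open>m\<close>.\<close>
  have rot: "(shift k ^^ i) t = rotate (m * i) t" for i
  proof -
    have "length ((shift k ^^ i) t) = Suc m" using t(1)[of i] by (simp add: words_def)
    hence "rotate (Suc m * i) ((shift k ^^ i) t) = (shift k ^^ i) t"
      using rotate_conv_mod[of "Suc m * i" "(shift k ^^ i) t"] by (simp del: mult_Suc)
    thus ?thesis using unrotate[of i] by (metis mult_Suc rotate_rotate add.commute)
  qed
  \<comment> \<open>The zero word has no good rotation, but \<open>shift\<close> does not merely
    rotate it either.\<close>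
  have "\<exists>a \<in> set t. a \<noteq> 0"
  proof (rule ccontr)
    assume "\<not> ?thesis"
    hence z: "t = replicate m 0 @ [0]" using lt
      by (metis replicate_Suc replicate_append_same replicate_eqI)
    have "replicate m 0 \<in> words k m" using k by (auto simp: words_def)
    from shift_snoc_words[OF this, of 0] have "shift k t = 1 # replicate m 0"
      using k good_unit[of 1 m] z by simp
    thus False using step(1)[of 0] z by (cases m) auto
  qed
  then obtain r where r: "good (rotate r t)" using exists_good_rotation by blast
  \<comment> \<open>\<open>m\<close> is \<open>- 1\<close> modulo \<open>m + 1\<close>, so
    \<open>m * m * r\<close> is congruent to \<open>r\<close>.\<close>
  have "(shift k ^^ (m * r)) t = rotate r t"
  proof -
    have "m * (m * r) mod Suc m = r mod Suc m"
    proof -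
      have "int (m * (m * r)) mod int (Suc m) = int r mod int (Suc m)"
        by (subst mod_eq_dvd_iff, rule dvdI[of _ _ "(int m - 1) * int r"]) (simp add: algebra_simps)
      thus ?thesis by (metis zmod_int of_nat_eq_iff)
    qed
    thus ?thesis using rot[of "m * r"] lt rotate_conv_mod by metis
  qed
  thus False using r step(2) by metis
qed

end

text \<open>The orbit of \<open>g w\<close> reaches \<open>w\<close>, so \<open>w\<close> is
  periodic. Its least period gives distinct iterates, and since iterates of \<open>g\<close> are
  injective, every element that reaches \<open>w\<close> lies on its cycle.\<close>

lemma single_cycle:
  assumes fin: "finite W" and inj: "inj_on g W" and closed: "\<And>s. s \<in> W \<Longrightarrow> g s \<in> W"
    and w: "w \<in> W" and reach: "\<And>s. s \<in> W \<Longrightarrow> \<exists>i. (g ^^ i) s = w"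
  shows "(g ^^ card W) w = w" "bij_betw (\<lambda>i. (g ^^ i) w) {..<card W} W"
proof -
  have closed': "s \<in> W \<Longrightarrow> (g ^^ i) s \<in> W" for i s by (induction i) (auto simp: closed)
  have inj': "(g ^^ i) s = (g ^^ i) t \<Longrightarrow> s \<in> W \<Longrightarrow> t \<in> W \<Longrightarrow> s = t" for i s t
    by (induction i) (use closed' inj in \<open>auto dest: inj_onD\<close>)
  obtain i where "(g ^^ i) (g w) = w" using reach[OF closed[OF w]] by blast
  hence ex: "\<exists>p. 0 < p \<and> (g ^^ p) w = w" by (metis comp_apply funpow_Suc_right zero_less_Suc)
  define p where "p = (LEAST p. 0 < p \<and> (g ^^ p) w = w)"
  have p: "0 < p" "(g ^^ p) w = w" unfolding p_def using LeastI_ex[OF ex] by auto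
  have least: "p \<le> q" if "0 < q" "(g ^^ q) w = w" for q
    unfolding p_def by (rule Least_le) (use that in simp)
  have period: "(g ^^ (p * q)) w = w" for q
    by (induction q) (simp_all add: funpow_add p(2))
  have mod: "(g ^^ (i mod p)) w = (g ^^ i) w" for i
  proof -
    have "(g ^^ i) w = (g ^^ (i mod p + p * (i div p))) w" by simp
    also have "\<dots> = (g ^^ (i mod p)) w" unfolding funpow_add using period by simp
    finally show ?thesis by simp
  qed
  have "inj_on (\<lambda>i. (g ^^ i) w) {..<p}"
  proof (rule linorder_inj_onI')
    fix i j assume ij: "i \<in> {..<p}" "j \<in> {..<p}" "i < j"
    show "(g ^^ i) w \<noteq> (g ^^ j) w"
    proof
      assume "(g ^^ i) w = (g ^^ j) w"
      also have "\<dots> = (g ^^ i) ((g ^^ (j - i)) w)" using ij by (simp flip: funpow_add comp_apply[of "g ^^ i"])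
      finally have "w = (g ^^ (j - i)) w" using inj' closed' w by blast
      hence "p \<le> j - i" using ij by (intro least) auto
      thus False using ij by auto
    qed
  qed
  moreover have "(\<lambda>i. (g ^^ i) w) ` {..<p} = W"
  proof
    show "(\<lambda>i. (g ^^ i) w) ` {..<p} \<subseteq> W" using closed' w by blast
    show "W \<subseteq> (\<lambda>i. (g ^^ i) w) ` {..<p}"
    proof
      fix s assume s: "s \<in> W"
      obtain i where i: "(g ^^ i) s = w" using reach[OF s] by blast
      \<comment> \<open>Walking \<open>p * i - i\<close> steps from \<open>w\<close> leads to the
        element that needs \<open>i\<close> more steps to return to \<open>w\<close>, which must be
        \<open>s\<close>.\<close>
      have "i \<le> p * i" using p(1) by simp
      hence "(g ^^ i) ((g ^^ (p * i - i)) w) = w"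
        using period[of i] by (simp flip: funpow_add comp_apply[of "g ^^ i"])
      hence "s = (g ^^ (p * i - i)) w" using i inj' s closed'[OF w] by metis
      thus "s \<in> (\<lambda>i. (g ^^ i) w) ` {..<p}" using mod[of "p * i - i"] p(1)
        by (metis image_eqI lessThan_iff mod_less_divisor)
    qed
  qed
  ultimately have bij: "bij_betw (\<lambda>i. (g ^^ i) w) {..<p} W" by (simp add: bij_betw_def)
  hence "card W = p" by (metis bij_betw_same_card card_lessThan)
  thus "(g ^^ card W) w = w" "bij_betw (\<lambda>i. (g ^^ i) w) {..<card W} W" using p bij by auto
qed

text \<open>The cycle of \<open>shift\<close>, read backwards from \<open>start k m\<close>, is
  shown to obey the greedy rule by induction.\<close>

theorem shift_prefer_max_cycle:
  assumes n: "1 \<le> n" and k: "2 \<le> k"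
  shows "shift k (prefer_max_cycle k n i) = prefer_max_cycle k n (i - 1)"
proof -
  obtain m where m: "n = Suc m" using n by (cases n) auto
  define K where "K = k ^ n"
  define W where "W = words k (Suc m)"
  have K: "K > 0" "card W = K" using k by (simp_all add: K_def W_def m card_words)
  note cycle = single_cycle[OF finite_words inj_on_shift[OF k, of m] shift_in_words[OF k]
      start_in_words[OF k, of m] shift_reaches_start[OF k, of _ m], folded W_def, unfolded K]
  have cyc: "(shift k ^^ K) (start k m) = start k m"
    "bij_betw (\<lambda>i. (shift k ^^ i) (start k m)) {..<K} W"
    using cycle by blast+
  \<comment> \<open>Going backwards, \<open>u\<close> turns \<open>shift\<close> into the
    predecessor map; at index 0 a full turn returns to the start.\<close>
  define u where "u i = (shift k ^^ (K - i)) (start k m)" for i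
  have u_W: "u i \<in> W" for i
    unfolding u_def W_def by (intro shift_power_in_words start_in_words k)
  have u_0: "u 0 = start k m" using cyc(1) by (simp add: u_def)
  have u_Suc: "shift k (u (Suc i)) = u i" if "i < K" for i
  proof -
    have "K - i = Suc (K - Suc i)" using that by simp
    thus ?thesis by (simp add: u_def)
  qed
  have u_last: "shift k (u 0) = u (K - 1)"
    using K(1) unfolding u_0 by (simp add: u_def)
  have u_bij: "bij_betw u {..<K} W"
  proof -
    have "u i = (shift k ^^ ((K - i) mod K)) (start k m)" if "i < K" for i
      using that cyc(1) by (cases "i = 0") (simp_all add: u_def)
    hence eq: "u i = ((\<lambda>i. (shift k ^^ i) (start k m)) \<circ> (\<lambda>i. (K - i) mod K)) i" if "i \<in> {..<K}" for i
      using that by simp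
    have "bij_betw (\<lambda>i. (K - i) mod K) {..<K} {..<K}"
    proof (rule bij_betw_byWitness[where f' = "\<lambda>i. (K - i) mod K"])
      show "\<forall>i\<in>{..<K}. (K - (K - i) mod K) mod K = i"
      proof
        fix i assume "i \<in> {..<K}"
        thus "(K - (K - i) mod K) mod K = i" by (cases "i = 0") auto
      qed
      thus "\<forall>i\<in>{..<K}. (K - (K - i) mod K) mod K = i" .
    qed (use K in auto)
    from bij_betw_trans[OF this cyc(2)] show ?thesis
      by (subst bij_betw_cong[OF eq])
  qed
  have u_inj: "u i = u j \<longleftrightarrow> i = j" if "i < K" "j < K" for i j
    using u_bij that by (auto simp: bij_betw_def dest: inj_onD)
  \<comment> \<open>By \<open>key_shift\<close> read backwards; injectivity of \<open>u\<close>
    keeps positive indices away from the exceptional word \<open>start k m\<close>.\<close>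
  have u_key: "key k (u (i + d)) \<le> key k (u i)" if "i + d < K" for i d
    using that
  proof (induction d)
    case (Suc d)
    have "u (Suc (i + d)) \<noteq> start k m" using u_inj[of "Suc (i + d)" 0] Suc.prems K u_0 by auto
    from key_shift[OF k u_W[unfolded W_def] this] have "key k (u (Suc (i + d))) \<le> key k (u (i + d))"
      using u_Suc[of "i + d"] Suc.prems by auto
    thus ?case using Suc by simp
  qed simp
  have u_eq: "prefer_max k n i = u i" if "i < K" for i
    using that
  proof (induction i rule: less_induct)
    case (less i)
    show ?case
    proof (cases i)
      case 0
      thus ?thesis by (simp add: u_0 m)
    next
      case (Suc i')
      obtain x a where xa: "u i = x @ [a]" "x \<in> words k m" "a < k"
        using u_W[of i] unfolding W_def by (rule words_SucE)
      have tl: "tl (u i') = x"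
        using tl_shift[OF k u_W[of i, unfolded W_def]] u_Suc[of i'] less.prems Suc xa(1) by simp
      have img: "prefer_max k n ` {..i'} = u ` {..i'}"
        using less Suc by (intro image_cong) auto
      let ?S = "{b. b < k \<and> x @ [b] \<notin> u ` {..i'}}"
      have "Max ?S = a"
      proof (rule Max_eqI)
        have "u j \<noteq> u i" if "j \<le> i'" for j using u_inj[of j i] that less.prems Suc by auto
        hence "x @ [a] \<notin> u ` {..i'}" unfolding xa(1)[symmetric] by (metis atMost_iff image_iff)
        thus "a \<in> ?S" using xa(3) by simp
      next
        fix b assume b: "b \<in> ?S"
        show "b \<le> a"
        proof (rule ccontr)
          assume "\<not> b \<le> a"
          hence lt: "key k (x @ [a]) < key k (x @ [b])" by (intro key_snoc_less) simp
          have "x @ [b] \<in> W" using b xa(2) by (simp add: W_def words_snoc)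
          then obtain j where j: "j < K" "x @ [b] = u j" using u_bij by (auto simp: bij_betw_def)
          hence "i \<le> j" using b Suc by (auto simp: not_less_eq_eq)
          thus False using u_key[of i "j - i"] j lt xa(1) by simp
        qed
      qed simp
      thus ?thesis using Suc tl img xa(1) less by (simp add: Let_def)
    qed
  qed
  define r where "r = nat (i mod int K)"
  have r: "int r = i mod int K" "r < K" using K(1) by (simp_all add: r_def nat_less_iff)
  have "prefer_max_cycle k n i = u r" using r(2) u_eq by (simp add: prefer_max_cycle_def r_def K_def)
  moreover have "prefer_max_cycle k n (i - 1) = u (if r = 0 then K - 1 else r - 1)"
  proof -
    have "(i - 1) mod int K = (int r - 1) mod int K" unfolding r by (simp add: mod_diff_left_eq)
    also have "\<dots> = int (if r = 0 then K - 1 else r - 1)"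
      using r(2) K(1) by (auto simp: of_nat_diff zmod_minus1)
    finally have "nat ((i - 1) mod int K) = (if r = 0 then K - 1 else r - 1)" by simp
    thus ?thesis using u_eq r(2) K(1) by (simp add: prefer_max_cycle_def K_def[symmetric])
  qed
  moreover have "shift k (u r) = u (if r = 0 then K - 1 else r - 1)"
    using u_last u_Suc[of "r - 1"] r(2) by (cases r) auto
  ultimately show ?thesis by simp
qed

section \<open>Testing the maximality of a rotation in one scan\<close>

definition cyc :: "nat list \<Rightarrow> nat \<Rightarrow> nat" where
  "cyc l i = l ! (i mod length l)"

lemma nth_less_lex:
  "length l = length m \<Longrightarrow> q < length l \<Longrightarrow> (\<And>t. t < q \<Longrightarrow> l ! t = m ! t) \<Longrightarrow> l ! q < m ! q \<Longrightarrow> l < (m :: nat list)"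
proof (induction l m arbitrary: q rule: list_induct2)
  case (Cons a l b m)
  show ?case
  proof (cases q)
    case (Suc q')
    have "a = b" using Cons.prems(2)[of 0] Suc by simp
    moreover have "l < m"
      using Cons.prems(1,3) Cons.prems(2)[of "Suc _"] Suc by (intro Cons.IH[of q']) auto
    ultimately show ?thesis by simp
  qed (use Cons in simp)
qed simp

lemma nth_rotate_cyc: "t < length l \<Longrightarrow> rotate a l ! t = cyc l (a + t)"
  by (simp add: cyc_def nth_rotate)

text \<open>A mismatch at some \<open>q \<ge> length l\<close> would recur at
  \<open>q - length l\<close>, where the letters agree. So \<open>q\<close> lies within one
  period.\<close>

lemma rotate_less_cyc:
  assumes eq: "\<And>t. t < q \<Longrightarrow> cyc l (a + t) = cyc l (b + t)" and less: "cyc l (a + q) < cyc l (b + q)"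
    and "l \<noteq> []"
  shows "rotate a l < rotate b l"
proof -
  let ?n = "length l"
  have "q < ?n"
  proof (rule ccontr)
    assume "\<not> q < ?n"
    hence "cyc l (a + (q - ?n)) = cyc l (b + (q - ?n))" using \<open>l \<noteq> []\<close> \<open>\<not> q < ?n\<close>
      by (intro eq, cases l) auto
    moreover have "cyc l (i + (q - ?n)) = cyc l (i + q)" for i
    proof -
      have "i + q = i + (q - ?n) + ?n" using \<open>\<not> q < ?n\<close> by simp
      thus ?thesis unfolding cyc_def by (metis mod_add_self2)
    qed
    ultimately show False using less by simp
  qed
  thus ?thesis using eq less by (intro nth_less_lex[of _ _ q]) (auto simp: nth_rotate_cyc)
qed

text \<open>The scan at position \<open>i\<close> matches the prefix of length \<open>q\<close>; all rotations that start
  properly between \<open>0\<close> and \<open>i - q\<close> have been compared.\<close>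

definition scan_inv :: "nat list \<Rightarrow> nat \<Rightarrow> nat \<Rightarrow> bool" where
  "scan_inv l i q \<longleftrightarrow> q < i \<and> (\<forall>m < i - q. rotate m l \<le> l) \<and> (\<forall>t < q. cyc l (i - q + t) = cyc l t)"

lemma scan_inv_init: "scan_inv l 1 0"
  by (simp add: scan_inv_def)

lemma scan_inv_eq: "scan_inv l i q \<Longrightarrow> cyc l i = cyc l q \<Longrightarrow> scan_inv l (Suc i) (Suc q)"
  by (auto simp: scan_inv_def less_Suc_eq)

lemma scan_inv_greater: "scan_inv l i q \<Longrightarrow> cyc l q < cyc l i \<Longrightarrow> l \<noteq> [] \<Longrightarrow> \<not> maxrot l"
  using rotate_less_cyc[of q l 0 "i - q"] by (auto simp: scan_inv_def maxrot_def not_le)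

text \<open>A rotation starting \<open>d\<close> letters into the match follows
  \<open>rotate d l\<close> up to the smaller letter, so it is below \<open>rotate d l\<close>,
  which is handled by induction. One mismatch thus settles all these rotations.\<close>

lemma scan_inv_less:
  assumes inv: "scan_inv l i q" and less: "cyc l i < cyc l q" and "l \<noteq> []"
  shows "scan_inv l (Suc i) 0"
proof -
  define j where "j = i - q"
  have j: "0 < j" "i = j + q" and lt: "\<And>m. m < j \<Longrightarrow> rotate m l \<le> l"
    and eq: "\<And>t. t < q \<Longrightarrow> cyc l (j + t) = cyc l t"
    using inv by (auto simp: scan_inv_def j_def)
  have "rotate m l \<le> l" if "m \<le> i" for m
    using that
  proof (induction m rule: less_induct)
    case (less m)
    show ?case
    proof (cases "m < j")
      case False
      define d where "d = m - j"
      have d: "m = j + d" "d < m" "d \<le> q" using False less.prems j by (auto simp: d_def)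
      have "rotate m l < rotate d l"
      proof (rule rotate_less_cyc[of "q - d"])
        show "cyc l (m + t) = cyc l (d + t)" if "t < q - d" for t
          using eq[of "d + t"] that d(1) by (simp add: add.assoc)
        show "cyc l (m + (q - d)) < cyc l (d + (q - d))"
          using assms(2) d j by simp
      qed fact
      also have "rotate d l \<le> l" using less.IH[of d] d less.prems by simp
      finally show ?thesis by simp
    qed (rule lt)
  qed
  thus ?thesis by (simp add: scan_inv_def)
qed

text \<open>If the last match starts before \<open>length l\<close>, it is longer than
  \<open>l\<close>, so \<open>l\<close> equals its own rotation by \<open>j\<close> and later
  rotations repeat earlier ones. Otherwise all starts have been compared.\<close>

lemma scan_inv_end:
  assumes inv: "scan_inv l (2 * length l) q"
  shows "maxrot l"
proof -
  let ?n = "length l"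
  define j where "j = 2 * ?n - q"
  have j: "0 < j" and lt: "\<And>m. m < j \<Longrightarrow> rotate m l \<le> l"
    and eq: "\<And>t. t < q \<Longrightarrow> cyc l (j + t) = cyc l t"
    using inv by (auto simp: scan_inv_def j_def)
  show ?thesis
  proof (cases "?n \<le> j")
    case True
    have "rotate m l \<le> l" for m
    proof (cases "l = []")
      case False
      hence "m mod ?n < j" using True by (meson length_greater_0_conv mod_less_divisor order_less_le_trans)
      thus ?thesis using lt by (metis rotate_conv_mod)
    qed simp
    thus ?thesis by (simp add: maxrot_def)
  next
    case False
    have "rotate j l = l"
    proof (rule nth_equalityI)
      fix t assume "t < length (rotate j l)"
      moreover from this have "t < q" using False unfolding j_def by simp
      ultimately show "rotate j l ! t = l ! t" using eq[of t]
        by (simp add: nth_rotate_cyc) (simp add: cyc_def)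
    qed simp
    have "rotate m l \<le> l" for m
    proof (induction m rule: less_induct)
      case (less m)
      show ?case
      proof (cases "m < j")
        case False
        hence "rotate m l = rotate (m - j) (rotate j l)" by (simp add: rotate_rotate)
        thus ?thesis using less[of "m - j"] False j \<open>rotate j l = l\<close> by simp
      qed (rule lt)
    qed
    thus ?thesis by (simp add: maxrot_def)
  qed
qed


section \<open>Programs of the word RAM\<close>

text \<open>Fails on an access outside the first \<open>S\<close> cells or on a step after halting,
  so evaluating it proves the result and the memory bound together.\<close>

fun safe_run :: "nat \<Rightarrow> instr list \<Rightarrow> nat \<Rightarrow> nat \<Rightarrow> config \<Rightarrow> config option" where
  "safe_run w P S 0 c = Some c"
| "safe_run w P S (Suc t) c =
    (if pc c < length P \<and> instr_access (P ! pc c) c \<subseteq> {..<S} then safe_run w P S t (exec w (P ! pc c) c) else None)"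

lemma safe_run_numeral [simp]:
  "safe_run w P S (numeral v) c =
    (if pc c < length P \<and> instr_access (P ! pc c) c \<subseteq> {..<S}
     then safe_run w P S (pred_numeral v) (exec w (P ! pc c) c) else None)"
  by (simp add: numeral_eq_Suc)

lemma safe_run_add: "safe_run w P S (a + b) c = Option.bind (safe_run w P S a c) (safe_run w P S b)"
  by (induction a arbitrary: c) auto

definition reach :: "nat \<Rightarrow> instr list \<Rightarrow> nat \<Rightarrow> nat \<Rightarrow> (config \<Rightarrow> bool) \<Rightarrow> config \<Rightarrow> bool" where
  "reach w P S t Q c \<longleftrightarrow> (\<exists>t' \<le> t. \<exists>c'. safe_run w P S t' c = Some c' \<and> Q c')"

lemma reach_0: "Q c \<Longrightarrow> reach w P S t Q c"
  by (auto simp: reach_def intro!: exI[of _ 0])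

lemma reach_mono: "reach w P S t Q c \<Longrightarrow> t \<le> t' \<Longrightarrow> reach w P S t' Q c"
  unfolding reach_def by (meson order_trans)

lemma reach_run: "safe_run w P S a c = Some c' \<Longrightarrow> reach w P S t Q c' \<Longrightarrow> reach w P S (a + t) Q c"
  unfolding reach_def by (metis add_left_mono bind.bind_lunit safe_run_add)

lemma reach_trans:
  assumes "reach w P S t Q c" "\<And>c'. Q c' \<Longrightarrow> reach w P S t' R c'"
  shows "reach w P S (t + t') R c"
proof -
  obtain a c' where a: "a \<le> t" "safe_run w P S a c = Some c'" "Q c'" using assms(1) by (auto simp: reach_def)
  show ?thesis by (rule reach_mono[OF reach_run[OF a(2) assms(2)[OF a(3)]]]) (use a(1) in simp)
qed

lemma safe_run_run:
  "safe_run w P S t c = Some c' \<Longrightarrow> run w P t c = c' \<and> (\<forall>j < t. accessed P (run w P j c) \<subseteq> {..<S})"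
proof (induction t arbitrary: c)
  case (Suc t)
  hence c: "pc c < length P" "instr_access (P ! pc c) c \<subseteq> {..<S}"
    and run: "safe_run w P S t (exec w (P ! pc c) c) = Some c'" by (auto split: if_splits)
  have "step w P c = exec w (P ! pc c) c" using c by (simp add: step_def halted_def)
  hence *: "run w P (Suc j) c = run w P j (exec w (P ! pc c) c)" for j
    by (simp add: run_def funpow_swap1)
  have "accessed P (run w P j c) \<subseteq> {..<S}" if "j < Suc t" for j
  proof (cases j)
    case 0
    thus ?thesis using c by (simp add: run_def accessed_def halted_def)
  next
    case (Suc j')
    thus ?thesis using Suc.IH[OF run] that by (simp add: *)
  qed
  thus ?case using Suc.IH[OF run] by (simp add: *)
qed (simp add: run_def)

lemma computes_withinI:
  assumes "reach w P S T (\<lambda>c. halted P c \<and> map (mem c) [0..<length s'] = s') (init_config k s)"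
    "length s \<le> S" "length s' \<le> S"
  shows "computes_within w P k s s' T S"
  using assms safe_run_run unfolding reach_def computes_within_def by metis

section \<open>A program for shift\<close>

definition prog :: "instr list" where
  "prog =
    [\<comment> \<open>0: the letter \<open>a\<close> to be replaced, in register 6\<close>
     Imm 3 1, Arith Sub 5 0 3, Load 6 5, Arith Add 7 0 0,
     Arith Add 8 6 3, Arith Add 9 6 3, Jump_less 8 1 9,
     \<comment> \<open>7: second test, with \<open>a\<close> itself\<close>
     Arith Add 8 6 4, Arith Add 9 4 4,
     \<comment> \<open>9: is the word good after its last letter is replaced by register 8?\<close>
     Store 5 8, Jump_eq 8 4 30, Imm 10 0,
     Load 11 10, Jump_less 4 11 16, Arith Add 10 10 3, Jump 12,
     Imm 12 1,
     Imm 13 0,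
     \<comment> \<open>18: the scan, with \<open>i\<close> in register 12 and \<open>q\<close> in register 13\<close>
     Jump_eq 12 7 33,
     Arith Add 14 10 12, Arith Mod 14 14 0, Load 14 14,
     Arith Add 15 10 13, Arith Mod 15 15 0, Load 15 15,
     Jump_less 15 14 30, Arith Add 12 12 3, Jump_less 14 15 17, Arith Add 13 13 3, Jump 18,
     \<comment> \<open>30: not good\<close>
     Jump_eq 8 6 32, Jump 7, Arith Add 9 6 4,
     \<comment> \<open>33: output register 9 followed by all letters but the last\<close>
     Jump_eq 5 4 39, Arith Sub 10 5 3, Load 11 10, Store 5 11, Arith Add 5 10 4, Jump 33,
     Store 4 9]"

lemma length_prog [simp]: "length prog = 40"
  by (simp add: prog_def)

lemma prog_nth [simp]:
  "prog ! 0 = Imm 3 1" "prog ! Suc 0 = Arith Sub 5 0 3" "prog ! Suc (Suc 0) = Load 6 5"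
  "prog ! Suc (Suc (Suc 0)) = Arith Add 7 0 0"
  "prog ! 4 = Arith Add 8 6 3" "prog ! 5 = Arith Add 9 6 3" "prog ! 6 = Jump_less 8 1 9"
  "prog ! 7 = Arith Add 8 6 4" "prog ! 8 = Arith Add 9 4 4"
  "prog ! 9 = Store 5 8" "prog ! 10 = Jump_eq 8 4 30" "prog ! 11 = Imm 10 0"
  "prog ! 12 = Load 11 10" "prog ! 13 = Jump_less 4 11 16" "prog ! 14 = Arith Add 10 10 3" "prog ! 15 = Jump 12"
  "prog ! 16 = Imm 12 1" "prog ! 17 = Imm 13 0" "prog ! 18 = Jump_eq 12 7 33"
  "prog ! 19 = Arith Add 14 10 12" "prog ! 20 = Arith Mod 14 14 0" "prog ! 21 = Load 14 14"
  "prog ! 22 = Arith Add 15 10 13" "prog ! 23 = Arith Mod 15 15 0" "prog ! 24 = Load 15 15"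
  "prog ! 25 = Jump_less 15 14 30" "prog ! 26 = Arith Add 12 12 3" "prog ! 27 = Jump_less 14 15 17"
  "prog ! 28 = Arith Add 13 13 3" "prog ! 29 = Jump 18"
  "prog ! 30 = Jump_eq 8 6 32" "prog ! 31 = Jump 7" "prog ! 32 = Arith Add 9 6 4"
  "prog ! 33 = Jump_eq 5 4 39" "prog ! 34 = Arith Sub 10 5 3" "prog ! 35 = Load 11 10" "prog ! 36 = Store 5 11"
  "prog ! 37 = Arith Add 5 10 4" "prog ! 38 = Jump 33" "prog ! 39 = Store 4 9"
  by (simp_all add: prog_def)

text \<open>What the stages of the program share: \<open>a\<close> is the original last letter,
  \<open>b\<close> the letter under test, and \<open>out\<close> the first letter of the output if
  the test succeeds.\<close>

definition frame :: "nat \<Rightarrow> nat \<Rightarrow> nat \<Rightarrow> nat \<Rightarrow> nat \<Rightarrow> (nat \<Rightarrow> nat) \<Rightarrow> bool" where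
  "frame n k a b out f \<longleftrightarrow> f 0 = n \<and> f 1 = k \<and> f 3 = 1 \<and> f 4 = 0 \<and> f 5 = n - 1 \<and> f 6 = a \<and>
     f 7 = 2 * n \<and> f 8 = b \<and> f 9 = out"

section \<open>Correctness and running time of the program\<close>

context
  fixes w n k S :: nat
  assumes n: "1 \<le> n" and k: "2 \<le> k" and w: "3 * n < 2 ^ w" "k < 2 ^ w" and S: "n \<le> S"
begin

lemma w1: "1 < (2 :: nat) ^ w" "w \<noteq> 0"
proof -
  show "1 < (2 :: nat) ^ w" using w(2) k by simp
  thus "w \<noteq> 0" by (metis less_irrefl power_0)
qed

text \<open>The rotation is addressed through the offset \<open>z\<close> modulo \<open>n\<close>
  instead of being built. A round takes 7 steps up to the comparison of two letters and at most 5
  from there; \<open>z + i < 3 * n\<close> rules out overflow.\<close>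

lemma scan_maxrot:
  assumes s: "length s = n" "\<And>i. i < n \<Longrightarrow> M i = s ! i" and z: "z < n"
    and f: "frame n k a b out f" "f 10 = z" "f 12 = i" "f 13 = q"
    and inv: "scan_inv (rotate z s) i q" "i \<le> 2 * n"
  shows "reach w prog S (12 * (2 * n - i) + 1)
     (\<lambda>c. pc c = (if maxrot (rotate z s) then 33 else 30) \<and> frame n k a b out (reg c) \<and> mem c = M)
     \<lparr>pc = 18, reg = f, mem = M\<rparr>"
  using f inv
proof (induction "2 * n - i" arbitrary: i q f rule: less_induct)
  case (less i q f)
  let ?l = "rotate z s"
  let ?Q = "\<lambda>c. pc c = (if maxrot ?l then 33 else 30) \<and> frame n k a b out (reg c) \<and> mem c = M"
  note f = less.prems(1)[unfolded frame_def]
  have ne: "?l \<noteq> []" "n > 0" using n s by auto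
  have q: "q < i" using less.prems(5) by (simp add: scan_inv_def)
  show ?case
  proof (cases "i = 2 * n")
    case True
    have "maxrot ?l" using less.prems(5) True s(1) by (intro scan_inv_end[of _ q]) simp
    hence "reach w prog S 0 ?Q \<lparr>pc = 33, reg = f, mem = M\<rparr>"
      using less.prems(1) by (intro reach_0) simp
    moreover have "safe_run w prog S 1 \<lparr>pc = 18, reg = f, mem = M\<rparr> = Some \<lparr>pc = 33, reg = f, mem = M\<rparr>"
      using f less.prems True by simp
    ultimately show ?thesis using True reach_run by fastforce
  next
    case False
    hence i: "i < 2 * n" using less.prems(6) by simp
    define u where "u = cyc ?l i"
    define v where "v = cyc ?l q"
    have M: "M ((z + j) mod n) = cyc ?l j" for j
      using s ne by (simp add: cyc_def nth_rotate mod_add_right_eq)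
    have S': "(z + j) mod n < S" for j
      using ne S by (meson mod_less_divisor order_less_le_trans)
    define g where "g = f(14 := u, 15 := v)"
    have run7: "safe_run w prog S 7 \<lparr>pc = 18, reg = f, mem = M\<rparr> = Some \<lparr>pc = 25, reg = g, mem = M\<rparr>"
      using f less.prems i q z w S' by (simp add: M u_def v_def g_def fun_upd_twist)
    have g: "frame n k a b out g" "g 10 = z" "g 12 = i" "g 13 = q" "g 14 = u" "g 15 = v"
      using less.prems by (auto simp: g_def frame_def)
    note g' = g(1)[unfolded frame_def]
    consider "v < u" | "u < v" | "u = v" by linarith
    then show ?thesis
    proof cases
      case 1
      hence "\<not> maxrot ?l" using scan_inv_greater[OF less.prems(5)] ne by (simp add: u_def v_def)
      hence "reach w prog S 0 ?Q \<lparr>pc = 30, reg = g, mem = M\<rparr>"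
        using g(1) by (intro reach_0) simp
      moreover have "safe_run w prog S 1 \<lparr>pc = 25, reg = g, mem = M\<rparr> = Some \<lparr>pc = 30, reg = g, mem = M\<rparr>"
        using g 1 by simp
      ultimately have "reach w prog S (7 + (1 + 0)) ?Q \<lparr>pc = 18, reg = f, mem = M\<rparr>"
        using run7 reach_run by blast
      thus ?thesis by (rule reach_mono) (use i in simp)
    next
      case 2
      have "scan_inv ?l (i + 1) 0"
        using scan_inv_less[OF less.prems(5)] 2 ne by (simp add: u_def v_def)
      hence "reach w prog S (12 * (2 * n - (i + 1)) + 1) ?Q \<lparr>pc = 18, reg = g(12 := i + 1, 13 := 0), mem = M\<rparr>"
        using i g by (intro less.hyps) (auto simp: frame_def)
      moreover have "safe_run w prog S 4 \<lparr>pc = 25, reg = g, mem = M\<rparr> =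
          Some \<lparr>pc = 18, reg = g(12 := i + 1, 13 := 0), mem = M\<rparr>"
        using g g' 2 i w by simp
      ultimately have "reach w prog S (7 + (4 + (12 * (2 * n - (i + 1)) + 1))) ?Q \<lparr>pc = 18, reg = f, mem = M\<rparr>"
        using run7 reach_run by blast
      thus ?thesis by (rule reach_mono) (use i in simp)
    next
      case 3
      have "scan_inv ?l (i + 1) (q + 1)"
        using scan_inv_eq[OF less.prems(5)] 3 by (simp add: u_def v_def)
      hence "reach w prog S (12 * (2 * n - (i + 1)) + 1) ?Q \<lparr>pc = 18, reg = g(12 := i + 1, 13 := q + 1), mem = M\<rparr>"
        using i g by (intro less.hyps) (auto simp: frame_def)
      moreover have "safe_run w prog S 5 \<lparr>pc = 25, reg = g, mem = M\<rparr> =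
          Some \<lparr>pc = 18, reg = g(12 := i + 1, 13 := q + 1), mem = M\<rparr>"
        using g g' 3 i q w by simp
      ultimately have "reach w prog S (7 + (5 + (12 * (2 * n - (i + 1)) + 1))) ?Q \<lparr>pc = 18, reg = f, mem = M\<rparr>"
        using run7 reach_run by blast
      thus ?thesis by (rule reach_mono) (use i in simp)
    qed
  qed
qed

lemma zeros_eqI:
  assumes "z < length s" "s ! z \<noteq> 0" "\<And>j. j < z \<Longrightarrow> s ! j = 0"
  shows "zeros s = z"
proof -
  have "takeWhile (\<lambda>a. a = 0) s = take z s"
    by (rule takeWhile_eq_take_P_nth) (use assms in auto)
  thus ?thesis using assms(1) by (simp add: zeros_def)
qed

text \<open>The nonzero last letter stops the loop inside the word, with four steps per leading
  zero.\<close>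

lemma skip_zeros:
  assumes s: "length s = n" "\<And>i. i < n \<Longrightarrow> M i = s ! i" and last: "last s \<noteq> 0"
    and f: "frame n k a b out f" "f 10 = i" "i < n" "\<And>j. j < i \<Longrightarrow> s ! j = 0"
  shows "reach w prog S (4 * (n - i))
     (\<lambda>c. \<exists>g. c = \<lparr>pc = 16, reg = g, mem = M\<rparr> \<and> frame n k a b out g \<and> g 10 = zeros s \<and> zeros s < n)
     \<lparr>pc = 12, reg = f, mem = M\<rparr>"
  using f
proof (induction "n - i" arbitrary: i f rule: less_induct)
  case (less i f)
  let ?Q = "\<lambda>c. \<exists>g. c = \<lparr>pc = 16, reg = g, mem = M\<rparr> \<and> frame n k a b out g \<and> g 10 = zeros s \<and> zeros s < n"
  note f = less.prems(1)[unfolded frame_def]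
  show ?case
  proof (cases "s ! i = 0")
    case True
    have "s \<noteq> []" using s(1) n by auto
    hence "s ! (n - 1) \<noteq> 0" using last s(1) by (simp add: last_conv_nth)
    hence "i \<noteq> n - 1" using True by metis
    hence i: "i + 1 < n" using less.prems(3) by simp
    have "reach w prog S (4 * (n - (i + 1))) ?Q \<lparr>pc = 12, reg = f(11 := 0, 10 := i + 1), mem = M\<rparr>"
      using less.prems i True by (intro less.hyps) (auto simp: frame_def less_Suc_eq)
    moreover have "safe_run w prog S 4 \<lparr>pc = 12, reg = f, mem = M\<rparr> =
        Some \<lparr>pc = 12, reg = f(11 := 0, 10 := i + 1), mem = M\<rparr>"
      using f less.prems True S i w s by simp
    ultimately have "reach w prog S (4 + 4 * (n - (i + 1))) ?Q \<lparr>pc = 12, reg = f, mem = M\<rparr>"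
      using reach_run by blast
    thus ?thesis by (rule reach_mono) (use i in simp)
  next
    case False
    have z: "zeros s = i" using less.prems False s(1) by (intro zeros_eqI) auto
    have "safe_run w prog S 2 \<lparr>pc = 12, reg = f, mem = M\<rparr> = Some \<lparr>pc = 16, reg = f(11 := s ! i), mem = M\<rparr>"
      using f less.prems False S s by simp
    moreover have "reach w prog S 0 ?Q \<lparr>pc = 16, reg = f(11 := s ! i), mem = M\<rparr>"
      using less.prems z by (intro reach_0) (auto simp: frame_def)
    ultimately have "reach w prog S (2 + 0) ?Q \<lparr>pc = 12, reg = f, mem = M\<rparr>"
      using reach_run by blast
    thus ?thesis by (rule reach_mono) (use less.prems in simp)
  qed
qed

lemma good_iff:
  assumes "last s \<noteq> 0" "s \<noteq> []"
  shows "good s \<longleftrightarrow> maxrot (rotate (zeros s) s)"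
proof -
  have "core s \<noteq> []" using assms last_in_set[OF assms(2)] by (metis core_eq_Nil_iff singletonD subsetD)
  thus ?thesis using assms by (simp add: good_def aligned_def rotate_zeros)
qed

text \<open>\<open>b = 0\<close> is settled first, since skipping zeros relies on a nonzero last
  letter. Only the cells of \<open>x\<close> are prescribed, so the second test may start from the
  memory left by the first.\<close>

lemma test_good:
  assumes x: "length x = n - 1" "\<And>i. i < n - 1 \<Longrightarrow> M i = x ! i"
    and f: "frame n k a b out f"
  shows "reach w prog S (30 * n + 5)
     (\<lambda>c. pc c = (if good (x @ [b]) then 33 else 30) \<and> frame n k a b out (reg c) \<and> mem c = M(n - 1 := b))
     \<lparr>pc = 9, reg = f, mem = M\<rparr>"
proof -
  let ?s = "x @ [b]"
  let ?M = "M(n - 1 := b)"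
  let ?Q = "\<lambda>c. pc c = (if good ?s then 33 else 30) \<and> frame n k a b out (reg c) \<and> mem c = ?M"
  note f' = f[unfolded frame_def]
  have len: "length ?s = n" using x n by simp
  have M: "?M i = ?s ! i" if "i < n" for i using that x by (auto simp: nth_append)
  show ?thesis
  proof (cases "b = 0")
    case True
    have "safe_run w prog S 2 \<lparr>pc = 9, reg = f, mem = M\<rparr> = Some \<lparr>pc = 30, reg = f, mem = ?M\<rparr>"
      using f' True n S by simp
    moreover have "reach w prog S 0 ?Q \<lparr>pc = 30, reg = f, mem = ?M\<rparr>"
      using f True by (intro reach_0) (auto simp: good_def)
    ultimately have "reach w prog S (2 + 0) ?Q \<lparr>pc = 9, reg = f, mem = M\<rparr>"
      using reach_run by blast
    thus ?thesis by (rule reach_mono) simp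
  next
    case False
    have run3: "safe_run w prog S 3 \<lparr>pc = 9, reg = f, mem = M\<rparr> = Some \<lparr>pc = 12, reg = f(10 := 0), mem = ?M\<rparr>"
      using f' False n S by simp
    have "reach w prog S (4 * (n - 0) + (2 + (12 * (2 * n - 1) + 1))) ?Q \<lparr>pc = 12, reg = f(10 := 0), mem = ?M\<rparr>"
    proof (rule reach_trans[OF skip_zeros[where s = ?s and a = a and b = b and out = out]])
      fix c assume "\<exists>g. c = \<lparr>pc = 16, reg = g, mem = ?M\<rparr> \<and> frame n k a b out g \<and> g 10 = zeros ?s \<and> zeros ?s < n"
      then obtain g where g: "c = \<lparr>pc = 16, reg = g, mem = ?M\<rparr>" "frame n k a b out g" "g 10 = zeros ?s"
        "zeros ?s < n" by blast
      have "safe_run w prog S 2 c = Some \<lparr>pc = 18, reg = g(12 := 1, 13 := 0), mem = ?M\<rparr>"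
        using w1 by (simp add: g(1))
      moreover have "reach w prog S (12 * (2 * n - 1) + 1) ?Q \<lparr>pc = 18, reg = g(12 := 1, 13 := 0), mem = ?M\<rparr>"
        unfolding good_iff[of ?s, simplified, OF False[THEN neq0_conv[THEN iffD1]]]
        using g n scan_inv_init by (intro scan_maxrot[OF len M]) (auto simp: frame_def)
      ultimately show "reach w prog S (2 + (12 * (2 * n - 1) + 1)) ?Q c" by (rule reach_run)
    qed (use len M n f False in \<open>auto simp: frame_def\<close>)
    from reach_run[OF run3 this] show ?thesis by (rule reach_mono) (use n in simp)
  qed
qed

text \<open>Copying runs downwards, so each letter is moved before its cell is overwritten; cell
  \<open>i\<close> is the free one. A letter costs six steps.\<close>

lemma write_shifted:
  assumes x: "length x = n - 1"
    and f: "f 3 = 1" "f 4 = 0" "f 5 = i" "f 9 = out" and i: "i < n"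
    and M: "\<And>j. j < i \<Longrightarrow> M j = x ! j" "\<And>j. i \<le> j \<Longrightarrow> j < n - 1 \<Longrightarrow> M (Suc j) = x ! j"
  shows "reach w prog S (6 * i + 2) (\<lambda>c. halted prog c \<and> map (mem c) [0..<n] = out # x)
     \<lparr>pc = 33, reg = f, mem = M\<rparr>"
  using f i M
proof (induction i arbitrary: f M)
  case 0
  have "map (M(0 := out)) [0..<n] = out # x"
  proof (rule nth_equalityI)
    fix j assume "j < length (map (M(0 := out)) [0..<n])"
    thus "map (M(0 := out)) [0..<n] ! j = (out # x) ! j"
      using 0(7) x by (cases j) auto
  qed (use x n in simp)
  hence "reach w prog S 0 (\<lambda>c. halted prog c \<and> map (mem c) [0..<n] = out # x)
      \<lparr>pc = 40, reg = f, mem = M(0 := out)\<rparr>"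
    by (intro reach_0) (simp add: halted_def)
  moreover have "safe_run w prog S 2 \<lparr>pc = 33, reg = f, mem = M\<rparr> = Some \<lparr>pc = 40, reg = f, mem = M(0 := out)\<rparr>"
    using 0 S n by simp
  ultimately have "reach w prog S (2 + 0) (\<lambda>c. halted prog c \<and> map (mem c) [0..<n] = out # x)
      \<lparr>pc = 33, reg = f, mem = M\<rparr>"
    by (rule reach_run[rotated])
  thus ?case by (rule reach_mono) simp
next
  case (Suc i)
  let ?f = "f(10 := i, 11 := x ! i, 5 := i)" and ?M = "M(Suc i := x ! i)"
  have iw: "Suc i < 2 ^ w" using Suc.prems(5) w by simp
  have "reach w prog S (6 * i + 2) (\<lambda>c. halted prog c \<and> map (mem c) [0..<n] = out # x)
      \<lparr>pc = 33, reg = ?f, mem = ?M\<rparr>"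
  proof (rule Suc.IH)
    show "?M (Suc j) = x ! j" if "i \<le> j" "j < n - 1" for j
      using that Suc.prems(7)[of j] by (cases "i = j") auto
  qed (use Suc.prems in auto)
  moreover have "safe_run w prog S 6 \<lparr>pc = 33, reg = f, mem = M\<rparr> = Some \<lparr>pc = 33, reg = ?f, mem = ?M\<rparr>"
    using Suc.prems iw S by simp
  ultimately have "reach w prog S (6 + (6 * i + 2)) (\<lambda>c. halted prog c \<and> map (mem c) [0..<n] = out # x)
      \<lparr>pc = 33, reg = f, mem = M\<rparr>"
    by (rule reach_run[rotated])
  thus ?case by simp
qed

text \<open>\<open>d\<close> is the tested letter left in the last cell; the copying, or the output
  letter if \<open>n = 1\<close>, overwrites it.\<close>

lemma write_result:
  assumes "length x = n - 1" "\<And>i. i < n - 1 \<Longrightarrow> M i = x ! i" "frame n k a b out f"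
  shows "reach w prog S (6 * n) (\<lambda>c. halted prog c \<and> map (mem c) [0..<n] = out # x)
     \<lparr>pc = 33, reg = f, mem = M(n - 1 := d)\<rparr>"
proof -
  have "reach w prog S (6 * (n - 1) + 2) (\<lambda>c. halted prog c \<and> map (mem c) [0..<n] = out # x)
      \<lparr>pc = 33, reg = f, mem = M(n - 1 := d)\<rparr>"
    by (rule write_shifted) (use assms n in \<open>auto simp: frame_def\<close>)
  thus ?thesis by (rule reach_mono) (use n in simp)
qed

lemma second_phase:
  assumes x: "x @ [a] \<in> words k n" "\<And>i. i < n - 1 \<Longrightarrow> M i = x ! i"
    and f: "frame n k a a 0 f"
  shows "reach w prog S (36 * n + 9)
     (\<lambda>c. halted prog c \<and> map (mem c) [0..<n] = (if good (x @ [a]) then 0 else a) # x)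
     \<lparr>pc = 9, reg = f, mem = M\<rparr>"
proof -
  have x': "length x = n - 1" "a < k" using x(1) n by (auto simp: words_def)
  let ?Q = "\<lambda>c. halted prog c \<and> map (mem c) [0..<n] = (if good (x @ [a]) then 0 else a) # x"
  have "reach w prog S (30 * n + 5 + (2 + 6 * n)) ?Q \<lparr>pc = 9, reg = f, mem = M\<rparr>"
  proof (rule reach_trans[OF test_good[OF x'(1) x(2) f]])
    fix c :: config
    assume "pc c = (if good (x @ [a]) then 33 else 30) \<and> frame n k a a 0 (reg c) \<and> mem c = M(n - 1 := a)"
    then obtain g where c: "c = \<lparr>pc = if good (x @ [a]) then 33 else 30, reg = g, mem = M(n - 1 := a)\<rparr>"
      and g: "frame n k a a 0 g" by (cases c) auto
    note g' = g[unfolded frame_def]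
    show "reach w prog S (2 + 6 * n) ?Q c"
    proof (cases "good (x @ [a])")
      case True
      have "reach w prog S (6 * n) ?Q c"
        using write_result[OF x'(1) x(2) g] True by (simp add: c)
      thus ?thesis by (rule reach_mono) simp
    next
      case False
      \<comment> \<open>Registers 8 and 6 agree only in the second test, so the failure exit goes on
        to output \<open>a\<close>.\<close>
      have "safe_run w prog S 2 c = Some \<lparr>pc = 33, reg = g(9 := a), mem = M(n - 1 := a)\<rparr>"
        using g' w x'(2) False by (simp add: c)
      moreover have "frame n k a a a (g(9 := a))" using g' by (simp add: frame_def)
      hence "reach w prog S (6 * n) ?Q \<lparr>pc = 33, reg = g(9 := a), mem = M(n - 1 := a)\<rparr>"
        using write_result[OF x'(1) x(2)] False by simp
      ultimately show ?thesis by (rule reach_run)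
    qed
  qed
  thus ?thesis by (rule reach_mono) (use n in simp)
qed

lemma prog_computes_shift:
  assumes s: "s \<in> words k n"
  shows "reach w prog S (100 * n) (\<lambda>c. halted prog c \<and> map (mem c) [0..<n] = shift k s) (init_config k s)"
proof -
  obtain m where m: "n = Suc m" using n by (cases n) auto
  obtain x a where xa: "s = x @ [a]" "a < k" using s[unfolded m] by (rule words_SucE)
  have len: "length s = n" "length x = n - 1" using s xa by (auto simp: words_def)
  define M where "M = (\<lambda>i. if i < length s then s ! i else 0)"
  define f0 where "f0 = (\<lambda>_ :: nat. 0 :: nat)(0 := n, 1 := k)"
  have M: "M i = x ! i" if "i < n - 1" for i using that len xa(1) by (auto simp: M_def nth_append)
  have Ma: "M (n - Suc 0) = a" using len xa(1) n by (simp add: M_def nth_append)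
  have init: "init_config k s = \<lparr>pc = 0, reg = f0, mem = M\<rparr>"
    by (simp add: init_config_def f0_def M_def len)
  let ?Q = "\<lambda>c. halted prog c \<and> map (mem c) [0..<n] = shift k s"
  have shift: "shift k s = (if a + 1 < k \<and> good (x @ [a + 1]) then (a + 1) # x
      else (if good (x @ [a]) then 0 else a) # x)"
    unfolding xa(1) using shift_snoc[of x a k n] s xa(1) k by simp
  define f where "f = f0(3 := 1, 5 := n - 1, 6 := a, 7 := 2 * n)"
  have "n + 2 ^ w - Suc 0 = (n - Suc 0) + 2 ^ w" using n by simp
  hence "(n + 2 ^ w - Suc 0) mod 2 ^ w = n - Suc 0" using w(1) by (simp del: add_diff_assoc2)
  hence run4: "safe_run w prog S 4 (init_config k s) = Some \<lparr>pc = 4, reg = f, mem = M\<rparr>"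
    using w w1 S n Ma by (simp add: init f0_def f_def mult_2)
  have f: "f 0 = n" "f 1 = k" "f 3 = 1" "f 4 = 0" "f 5 = n - 1" "f 6 = a" "f 7 = 2 * n"
    by (simp_all add: f_def f0_def)
  show ?thesis
  proof (cases "a + 1 < k")
    case False
    define g where "g = f(8 := a, 9 := 0)"
    have g: "frame n k a a 0 g" using f by (simp add: frame_def g_def)
    \<comment> \<open>\<open>a + 1 = k < 2 ^ w\<close> does not wrap around, so the comparison with
      \<open>k\<close> fails and the first test is skipped.\<close>
    have "safe_run w prog S 5 \<lparr>pc = 4, reg = f, mem = M\<rparr> = Some \<lparr>pc = 9, reg = g, mem = M\<rparr>"
      using w(2) f False xa(2) by (simp add: g_def)
    moreover have "reach w prog S (36 * n + 9) ?Q \<lparr>pc = 9, reg = g, mem = M\<rparr>"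
      using second_phase[OF s[unfolded xa(1)] M g] False by (simp add: shift)
    ultimately have "reach w prog S (4 + (5 + (36 * n + 9))) ?Q (init_config k s)"
      using reach_run run4 by blast
    thus ?thesis by (rule reach_mono) (use n in simp)
  next
    case True
    define g where "g = f(8 := a + 1, 9 := a + 1)"
    have g: "frame n k a (a + 1) (a + 1) g" using f by (simp add: frame_def g_def)
    have run3: "safe_run w prog S 3 \<lparr>pc = 4, reg = f, mem = M\<rparr> = Some \<lparr>pc = 9, reg = g, mem = M\<rparr>"
      using w(2) f True by (simp add: g_def)
    have "reach w prog S (30 * n + 5 + (4 + (36 * n + 9))) ?Q \<lparr>pc = 9, reg = g, mem = M\<rparr>"
    proof (rule reach_trans[OF test_good[OF len(2) M g]])
      fix c :: config
      assume "pc c = (if good (x @ [a + 1]) then 33 else 30) \<and> frame n k a (a + 1) (a + 1) (reg c) \<and>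
        mem c = M(n - 1 := a + 1)"
      then obtain h where c: "c = \<lparr>pc = if good (x @ [a + 1]) then 33 else 30, reg = h, mem = M(n - 1 := a + 1)\<rparr>"
        and h: "frame n k a (a + 1) (a + 1) h" by (cases c) auto
      note h' = h[unfolded frame_def]
      show "reach w prog S (4 + (36 * n + 9)) ?Q c"
      proof (cases "good (x @ [a + 1])")
        case good: True
        have "shift k s = (a + 1) # x" using good True by (simp add: shift)
        hence "reach w prog S (6 * n) ?Q c"
          using write_result[OF len(2) M h] good by (simp add: c)
        thus ?thesis by (rule reach_mono) (use n in simp)
      next
        case good: False
        have "safe_run w prog S 4 c = Some \<lparr>pc = 9, reg = h(8 := a, 9 := 0), mem = M(n - 1 := a + 1)\<rparr>"
          using h' w w1 True good by (simp add: c)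
        moreover have "reach w prog S (36 * n + 9) ?Q \<lparr>pc = 9, reg = h(8 := a, 9 := 0), mem = M(n - 1 := a + 1)\<rparr>"
        proof -
          have "frame n k a a 0 (h(8 := a, 9 := 0))" using h' by (simp add: frame_def)
          from second_phase[OF s[unfolded xa(1)] _ this, of "M(n - 1 := a + 1)"] show ?thesis
            using good M by (simp add: shift)
        qed
        ultimately show ?thesis by (rule reach_run)
      qed
    qed
    from reach_run[OF run4 reach_run[OF run3 this]] show ?thesis by (rule reach_mono) (use n in simp)
  qed
qed

end

text \<open>With \<open>b\<close> digits, \<open>k \<ge> 2\<close> gives
  \<open>2 * n \<le> n * k < 2 ^ b\<close>, but \<open>3 * n\<close> may need more bits; doubling
  the word length makes room for \<open>4 * n\<close>.\<close>

lemma word_length_bounds: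
  assumes "1 \<le> n" "2 \<le> k"
  shows "3 * n < 2 ^ word_length 2 n k" "k < 2 ^ word_length 2 n k"
proof -
  define b where "b = floorlog 2 (n * k)"
  have "0 < n * k" using assms by simp
  hence b: "n * k < 2 ^ b" unfolding b_def using floorlog_bounds[of "n * k" 2] by simp
  have "n * 2 \<le> n * k" using assms(2) by (rule mult_le_mono2)
  hence nb: "2 * n < 2 ^ b" using b by linarith
  have "2 * (2 * n) < 2 ^ b * 2 ^ b"
    using nb assms by (intro mult_le_less_imp_less) linarith+
  thus "3 * n < 2 ^ word_length 2 n k"
    by (simp add: word_length_def b_def mult_2 power_add)
  have "k \<le> n * k" using assms by simp
  also have "\<dots> < 2 ^ b" by (rule b)
  also have "\<dots> \<le> 2 ^ word_length 2 n k" by (intro power_increasing) (auto simp: word_length_def b_def)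
  finally show "k < 2 ^ word_length 2 n k" .
qed

theorem shift_linear:
  assumes "1 \<le> n" "2 \<le> k" and s: "s \<in> words k n"
  shows "computes_within (word_length 2 n k) prog k s (shift k s) (100 * n) (100 * n)"
proof (rule computes_withinI)
  obtain m where m: "n = Suc m" using assms by (cases n) auto
  have len: "length (shift k s) = n" "length s = n"
    using shift_in_words[OF assms(2), of s m] s by (auto simp: m words_def)
  show "length s \<le> 100 * n" "length (shift k s) \<le> 100 * n" using len by auto
  show "reach (word_length 2 n k) prog (100 * n) (100 * n)
     (\<lambda>c. halted prog c \<and> map (mem c) [0..<length (shift k s)] = shift k s) (init_config k s)"
    unfolding len using assms word_length_bounds[OF assms(1,2)] by (intro prog_computes_shift) auto
qed

theorem theorem34:
  shows "(\<forall>n k :: nat. 1 \<le> n \<longrightarrow> 2 \<le> k \<longrightarrow>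
            (\<forall>i :: int. shift k (prefer_max_cycle k n i) = prefer_max_cycle k n (i - 1))) \<and>
         (\<exists>(P :: instr list) (c :: nat) (C :: nat). 0 < c \<and>
            (\<forall>n k :: nat. 1 \<le> n \<longrightarrow> 2 \<le> k \<longrightarrow>
              (\<forall>s \<in> words k n.
                computes_within (word_length c n k) P k s (shift k s) (C * n) (C * n))))"
  \<comment> \<open>The witnesses are \<open>prog\<close>, \<open>c = 2\<close> and
    \<open>C = 100\<close>.\<close>
  using shift_prefer_max_cycle shift_linear by (metis zero_less_numeral)

end
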